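(* Suppose that $T=\begin{bmatrix} V & E\\ 0 & S\end{bmatrix}\in\mathscr S_{\mathcal H_1,\mathcal H_2}$, $E$ is injective and $N\in B(\mathcal K_2)$ is a minimal normal extension of $S$. Let $E=W|E|$ be the polar decomposition of $E$. Then $|E|$ is injective, $W$ is an isometry and the following hold: (i) if $\begin{bmatrix}\tilde V&\tilde E\\0&N\end{bmatrix}\in\mathscr N_{\mathcal K_1,\mathcal K_2}$ is an entrywise extension of $T$ such that $|E|\subseteq|\tilde E|$, and $\tilde E=U|\tilde E|$ is the polar decomposition of $\tilde E$, then $\tilde E$ is injective, $|\tilde E|$ is the lift of $|E|$ relative to $\{N\}'$ and $U\in B(\mathcal K_2,\mathcal K_1)$ is an isometry such that $W\subseteq U$ and $\operatorname{ran}\tilde V\perp\operatorname{ran}U$; (ii) if $\tilde V\in B(\mathcal K_1)$ and $U\in B(\mathcal K_2,\mathcal K_1)$ are isometries such that $V\subseteq\tilde V$, $W\subseteq U$ and $\operatorname{ran}\tilde V\perp\operatorname{ran}U$, and $B\in B(\mathcal K_2)$ is the lift of $|E|$ relative to $\{N\}'$, then $\begin{bmatrix}\tilde V&\tilde E\\0&N\end{bmatrix}\in\mathscr N_{\mathcal K_1,\mathcal K_2}$ with $\tilde E:=UB$, $\begin{bmatrix} V & E\\ 0 & S\end{bmatrix}\preceq\begin{bmatrix}\tilde V&\tilde E\\0&N\end{bmatrix}$, $|E|\subseteq|\tilde E|$ and $\tilde E=UB$ is the polar decomposition of $\tilde E$.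
   Context: All Hilbert spaces are complex; $B(\mathcal H,\mathcal K)$ is the space of bounded linear operators and $B(\mathcal H)=B(\mathcal H,\mathcal H)$; $|E|=(E^*E)^{1/2}$; $\mathscr F'$ denotes the commutant of a set $\mathscr F$ of operators. $A\subseteq B$ means that $B$ extends $A$: the space(s) of $A$ are (isometrically) subspaces of the corresponding space(s) of $B$, and $Ah=Bh$ for all $h$ in the domain space of $A$. For nonzero Hilbert spaces $\mathcal H_1,\mathcal H_2$, the operator $\begin{bmatrix}V&E\\0&X\end{bmatrix}\in B(\mathcal H_1\oplus\mathcal H_2)$ is a Brownian-type operator if $V^*V=I$, $V^*E=0$ and $XE^*E=E^*EX$. It belongs to $\mathscr S_{\mathcal H_1,\mathcal H_2}$ (resp. $\mathscr N_{\mathcal H_1,\mathcal H_2}$) if in addition $X$ is subnormal (resp. normal). $S\in B(\mathcal H)$ is subnormal if $S\subseteq N$ for some normal $N\in B(\mathcal K)$, $\mathcal K\supseteq\mathcal H$ (a normal extension of $S$). The normal extension $N$ is minimal if $\mathcal K$ is the only closed subspace of $\mathcal K$ that contains $\mathcal H$ and reduces $N$. If $N\in B(\mathcal K)$ is a minimal normal extension of $S\in B(\mathcal H)$, $P$ is the orthogonal projection of $\mathcal K$ onto $\mathcal H$, and $A\in\{S,S^*\}'$, then the lift of $A$ relative to $\{N\}'$ is the (unique, always existing) operator $B\in\{N\}'\cap\{P\}'$ with $A\subseteq B$. For Brownian-type operators $|E|\in\{S,S^*\}'$. Entrywise extension: $\begin{bmatrix}A_{11}&A_{12}\\ A_{21}&A_{22}\end{bmatrix}\preceq\begin{bmatrix}\tilde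 A_{11}&\tilde A_{12}\\ \tilde A_{21}&\tilde A_{22}\end{bmatrix}$ (the latter is an entrywise extension of the former), for operators on $\mathcal H_1\oplus\mathcal H_2$ and $\mathcal K_1\oplus\mathcal K_2$ respectively, means $\mathcal H_j\subseteq\mathcal K_j$ and $A_{ij}h_j=\tilde A_{ij}h_j$ for all $h_j\in\mathcal H_j$ and $i,j\in\{1,2\}$. *)

theory Defs
  imports "HOL-Analysis.Analysis"
begin

section \<open>Complex Hilbert spaces\<close>

text \<open>
  A complex inner product space is a real one whose inner product is the real part of a
  complex inner product. Hence the norm, the topology and completeness of the library are
  the usual ones: the norm of \<open>x\<close> is the square root of \<open>cinner x x\<close>, since
  \<open>cinner x x\<close> is real by \<open>cinner_commute\<close>.
  The inner product is linear in the first argument.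
\<close>

class complex_inner = real_inner +
  fixes scaleC :: "complex \<Rightarrow> 'a \<Rightarrow> 'a" (infixr \<open>*\<^sub>C\<close> 75)
    and cinner :: "'a \<Rightarrow> 'a \<Rightarrow> complex"
  assumes scaleC_add_right: "a *\<^sub>C (x + y) = a *\<^sub>C x + a *\<^sub>C y"
    and scaleC_add_left: "(a + b) *\<^sub>C x = a *\<^sub>C x + b *\<^sub>C x"
    and scaleC_scaleC: "a *\<^sub>C b *\<^sub>C x = (a * b) *\<^sub>C x"
    and scaleC_of_real: "complex_of_real r *\<^sub>C x = scaleR r x"
    and cinner_commute: "cinner x y = cnj (cinner y x)"
    and cinner_add_left: "cinner (x + y) z = cinner x z + cinner y z"
    and cinner_scaleC_left: "cinner (a *\<^sub>C x) y = a * cinner x y"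
    and Re_cinner: "Re (cinner x y) = inner x y"

class chilbert = complex_inner + complete_space

text \<open>The orthogonal sum of two Hilbert spaces is their product.\<close>

instantiation prod :: (complex_inner, complex_inner) complex_inner
begin

definition scaleC_prod :: "complex \<Rightarrow> 'a \<times> 'b \<Rightarrow> 'a \<times> 'b" where
  "scaleC_prod a x = (a *\<^sub>C fst x, a *\<^sub>C snd x)"

definition cinner_prod :: "'a \<times> 'b \<Rightarrow> 'a \<times> 'b \<Rightarrow> complex" where
  "cinner_prod x y = cinner (fst x) (fst y) + cinner (snd x) (snd y)"

instance
proof
  fix x y :: "'a \<times> 'b"
  show "cinner x y = cnj (cinner y x)"
    unfolding cinner_prod_def complex_cnj_add
    using cinner_commute[of "fst x" "fst y"] cinner_commute[of "snd x" "snd y"] by simp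
qed (simp_all add: scaleC_prod_def cinner_prod_def scaleC_add_right scaleC_add_left
    scaleC_scaleC scaleC_of_real cinner_add_left cinner_scaleC_left Re_cinner
    inner_prod_def scaleR_prod_def algebra_simps)

end

instance prod :: (chilbert, chilbert) chilbert ..


section \<open>Bounded operators\<close>

definition bounded_ops :: "('a::complex_inner \<Rightarrow> 'b::complex_inner) set" where
  "bounded_ops = {A. bounded_linear A \<and> (\<forall>c x. A (c *\<^sub>C x) = c *\<^sub>C A x)}"

text \<open>
  The definite descriptions in \<open>adj\<close> and \<open>abs_op\<close> denote for bounded operators between
  Hilbert spaces, that in \<open>ortho_proj\<close> for closed subspaces of a Hilbert space.
\<close>

definition adj :: "('a::complex_inner \<Rightarrow> 'b::complex_inner) \<Rightarrow> 'b \<Rightarrow> 'a" where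
  "adj A = (THE B. \<forall>x y. cinner (A x) y = cinner x (B y))"

definition positive_op :: "('a::complex_inner \<Rightarrow> 'a) \<Rightarrow> bool" where
  "positive_op A \<longleftrightarrow> A \<in> bounded_ops \<and> (\<forall>x. cinner (A x) x \<in> \<real>\<^sub>\<ge>\<^sub>0)"

definition sqrt_op :: "('a::complex_inner \<Rightarrow> 'a) \<Rightarrow> 'a \<Rightarrow> 'a" where
  "sqrt_op A = (THE R. positive_op R \<and> R \<circ> R = A)"

definition abs_op :: "('a::complex_inner \<Rightarrow> 'b::complex_inner) \<Rightarrow> 'a \<Rightarrow> 'a" where
  "abs_op E = sqrt_op (adj E \<circ> E)"

definition isometry :: "('a::complex_inner \<Rightarrow> 'b::complex_inner) \<Rightarrow> bool" where
  "isometry V \<longleftrightarrow> V \<in> bounded_ops \<and> (\<forall>x. norm (V x) = norm x)"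

definition normal_op :: "('a::complex_inner \<Rightarrow> 'a) \<Rightarrow> bool" where
  "normal_op N \<longleftrightarrow> N \<in> bounded_ops \<and> adj N \<circ> N = N \<circ> adj N"

definition commutant :: "('a::complex_inner \<Rightarrow> 'a) set \<Rightarrow> ('a \<Rightarrow> 'a) set" where
  "commutant F = {B \<in> bounded_ops. \<forall>A\<in>F. A \<circ> B = B \<circ> A}"

definition orthogonal_sets :: "'a::complex_inner set \<Rightarrow> 'a set \<Rightarrow> bool" where
  "orthogonal_sets M L \<longleftrightarrow> (\<forall>x\<in>M. \<forall>y\<in>L. cinner x y = 0)"

definition ortho_compl :: "'a::complex_inner set \<Rightarrow> 'a set" where
  "ortho_compl M = {x. \<forall>y\<in>M. cinner x y = 0}"

definition ortho_proj :: "'a::complex_inner set \<Rightarrow> 'a \<Rightarrow> 'a" where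
  "ortho_proj M = (\<lambda>x. THE y. y \<in> M \<and> x - y \<in> ortho_compl M)"

definition closed_csubspace :: "'a::complex_inner set \<Rightarrow> bool" where
  "closed_csubspace M \<longleftrightarrow>
     closed M \<and> 0 \<in> M \<and> (\<forall>x\<in>M. \<forall>y\<in>M. x + y \<in> M) \<and> (\<forall>c. \<forall>x\<in>M. c *\<^sub>C x \<in> M)"

definition reduces :: "'a::complex_inner set \<Rightarrow> ('a \<Rightarrow> 'a) \<Rightarrow> bool" where
  "reduces M N \<longleftrightarrow> N ` M \<subseteq> M \<and> N ` ortho_compl M \<subseteq> ortho_compl M"

definition null_space :: "('a::complex_inner \<Rightarrow> 'b::complex_inner) \<Rightarrow> 'a set" where
  "null_space A = {x. A x = 0}"

definition partial_isometry :: "('a::complex_inner \<Rightarrow> 'b::complex_inner) \<Rightarrow> bool" where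
  "partial_isometry W \<longleftrightarrow>
     W \<in> bounded_ops \<and> (\<forall>x \<in> ortho_compl (null_space W). norm (W x) = norm x)"

text \<open>\<open>polar_decomposition E W R\<close>: the polar decomposition of \<open>E\<close> is \<open>E = W R\<close>.\<close>

definition polar_decomposition ::
    "('a::complex_inner \<Rightarrow> 'b::complex_inner) \<Rightarrow> ('a \<Rightarrow> 'b) \<Rightarrow> ('a \<Rightarrow> 'a) \<Rightarrow> bool" where
  "polar_decomposition E W R \<longleftrightarrow>
     R = abs_op E \<and> partial_isometry W \<and> null_space W = null_space E \<and> E = W \<circ> R"


section \<open>Extensions\<close>

text \<open>
  An inclusion of Hilbert spaces \<open>H \<subseteq> K\<close> is a linear isometry \<open>j\<close> from \<open>H\<close> to \<open>K\<close>; the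
  subspace is then \<open>range j\<close>. In \<open>op_extends j k A B\<close>, i.e.\ \<open>A \<subseteq> B\<close>, the maps \<open>j\<close> and \<open>k\<close>
  include the domain and the codomain of \<open>A\<close> in those of \<open>B\<close>.
\<close>

definition op_extends ::
    "('a::complex_inner \<Rightarrow> 'c::complex_inner) \<Rightarrow> ('b::complex_inner \<Rightarrow> 'd::complex_inner) \<Rightarrow>
     ('a \<Rightarrow> 'b) \<Rightarrow> ('c \<Rightarrow> 'd) \<Rightarrow> bool" where
  "op_extends j k A B \<longleftrightarrow> isometry j \<and> isometry k \<and> (\<forall>h. B (j h) = k (A h))"

definition normal_extension ::
    "('h::complex_inner \<Rightarrow> 'k::complex_inner) \<Rightarrow> ('h \<Rightarrow> 'h) \<Rightarrow> ('k \<Rightarrow> 'k) \<Rightarrow> bool" where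
  "normal_extension j S N \<longleftrightarrow> S \<in> bounded_ops \<and> normal_op N \<and> op_extends j j S N"

definition minimal_normal_extension ::
    "('h::complex_inner \<Rightarrow> 'k::complex_inner) \<Rightarrow> ('h \<Rightarrow> 'h) \<Rightarrow> ('k \<Rightarrow> 'k) \<Rightarrow> bool" where
  "minimal_normal_extension j S N \<longleftrightarrow> normal_extension j S N \<and>
     (\<forall>M. closed_csubspace M \<and> range j \<subseteq> M \<and> reduces M N \<longrightarrow> M = UNIV)"

text \<open>
  HOL cannot quantify over the space of the normal extension inside a definition, so that
  space is a type argument. In a hypothesis \<open>subnormal_op TYPE('l) S\<close> of a theorem in which
  \<open>'l\<close> is a type variable occurring nowhere else, it is existentially quantified.
\<close>

definition subnormal_op :: "'l::chilbert itself \<Rightarrow> ('h::chilbert \<Rightarrow> 'h) \<Rightarrow> bool" where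
  "subnormal_op TYPE('l) S \<longleftrightarrow> (\<exists>(j :: 'h \<Rightarrow> 'l) N. normal_extension j S N)"

text \<open>
  \<open>is_lift j N A B\<close>: \<open>B\<close> is the lift of \<open>A\<close> relative to the commutant of \<open>N\<close>. It is unique
  if \<open>N\<close> is a minimal normal extension (along \<open>j\<close>) of an operator \<open>S\<close> and \<open>A\<close> commutes with
  \<open>S\<close> and \<open>adj S\<close>.
\<close>

definition is_lift ::
    "('h::complex_inner \<Rightarrow> 'k::complex_inner) \<Rightarrow> ('k \<Rightarrow> 'k) \<Rightarrow> ('h \<Rightarrow> 'h) \<Rightarrow> ('k \<Rightarrow> 'k) \<Rightarrow> bool" where
  "is_lift j N A B \<longleftrightarrow>
     B \<in> commutant {N} \<inter> commutant {ortho_proj (range j)} \<and> op_extends j j A B"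


section \<open>Block operators\<close>

definition block_op ::
    "('a::complex_inner \<Rightarrow> 'c::complex_inner) \<Rightarrow> ('b::complex_inner \<Rightarrow> 'c) \<Rightarrow>
     ('a \<Rightarrow> 'd::complex_inner) \<Rightarrow> ('b \<Rightarrow> 'd) \<Rightarrow> 'a \<times> 'b \<Rightarrow> 'c \<times> 'd" where
  "block_op A11 A12 A21 A22 = (\<lambda>(x, y). (A11 x + A12 y, A21 x + A22 y))"

text \<open>
  \<open>entrywise_extends j1 j2 T T'\<close>: \<open>T'\<close> is an entrywise extension of \<open>T\<close>. For linear \<open>T\<close>, its
  entries are the maps \<open>\<lambda>x. fst (T (x, 0))\<close>, \<open>\<lambda>y. fst (T (0, y))\<close> (first row) and
  \<open>\<lambda>x. snd (T (x, 0))\<close>, \<open>\<lambda>y. snd (T (0, y))\<close> (second row).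
\<close>

definition entrywise_extends ::
    "('a::complex_inner \<Rightarrow> 'c::complex_inner) \<Rightarrow> ('b::complex_inner \<Rightarrow> 'd::complex_inner) \<Rightarrow>
     ('a \<times> 'b \<Rightarrow> 'a \<times> 'b) \<Rightarrow> ('c \<times> 'd \<Rightarrow> 'c \<times> 'd) \<Rightarrow> bool" where
  "entrywise_extends j1 j2 T T' \<longleftrightarrow>
     op_extends j1 j1 (\<lambda>x. fst (T (x, 0))) (\<lambda>x. fst (T' (x, 0))) \<and>
     op_extends j2 j1 (\<lambda>y. fst (T (0, y))) (\<lambda>y. fst (T' (0, y))) \<and>
     op_extends j1 j2 (\<lambda>x. snd (T (x, 0))) (\<lambda>x. snd (T' (x, 0))) \<and>
     op_extends j2 j2 (\<lambda>y. snd (T (0, y))) (\<lambda>y. snd (T' (0, y)))"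

definition brownian_type ::
    "('a::chilbert \<Rightarrow> 'a) \<Rightarrow> ('b::chilbert \<Rightarrow> 'a) \<Rightarrow> ('b \<Rightarrow> 'b) \<Rightarrow> bool" where
  "brownian_type V E X \<longleftrightarrow>
     (\<exists>x::'a. x \<noteq> 0) \<and> (\<exists>y::'b. y \<noteq> 0) \<and>
     V \<in> bounded_ops \<and> E \<in> bounded_ops \<and> X \<in> bounded_ops \<and>
     adj V \<circ> V = id \<and> adj V \<circ> E = (\<lambda>_. 0) \<and> X \<circ> adj E \<circ> E = adj E \<circ> E \<circ> X"

definition brownian_subnormal ::
    "'l::chilbert itself \<Rightarrow> ('a::chilbert \<times> 'b::chilbert \<Rightarrow> 'a \<times> 'b) set" where
  "brownian_subnormal TYPE('l) =
     {block_op V E (\<lambda>_. 0) X | V E X. brownian_type V E X \<and> subnormal_op TYPE('l) X}"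

definition brownian_normal :: "('a::chilbert \<times> 'b::chilbert \<Rightarrow> 'a \<times> 'b) set" where
  "brownian_normal =
     {block_op V E (\<lambda>_. 0) X | V E X. brownian_type V E X \<and> normal_op X}"

end

theory Submission
  imports Defs
begin

text \<open>
  Everything rests on two consequences of minimality. First, a positive operator that commutes with
  \<open>N\<close> and extends an injective operator is injective, because its kernel reduces \<open>N\<close> and is
  orthogonal to the space of \<open>S\<close>. Hence \<open>|E'|\<close> and \<open>B\<close> inherit injectivity from \<open>|E|\<close>, and identities
  such as \<open>U j = j W\<close> need only be checked on the dense ranges of these moduli. Second, the lift
  of a positive operator is positive, so that \<open>E' = U B\<close> is a polar decomposition by the uniqueness
  of positive square roots.
\<close>

section \<open>Complex inner products\<close>

text \<open>The difficulty in (ii) is that a lift is given only as an operator commuting with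
  \<open>N\<close> and with the projection onto \<open>range j\<close>; neither self-adjointness nor
  commutation with \<open>adj N\<close> belongs to the definition. Positivity is therefore obtained
  first, on a dense set, and commutation with \<open>adj N\<close> then follows by taking adjoints.
  In (i) the roles are reversed: the modulus of \<open>E'\<close> is positive by construction, and
  its commutation relations have to be derived. Both directions use one property of square roots:
  the root commutes with every bounded operator that commutes with its square. It carries the
  Brownian relation over to the modulus, yields uniqueness of positive roots, and makes a root
  constructed over the reals complex linear. For this reason the root is built as a limit of
  polynomials, and commutation is part of the existence statement.\<close>

lemma scaleC_diff_right: "c *\<^sub>C (x - y) = c *\<^sub>C x - c *\<^sub>C (y::'a::complex_inner)"
  by (metis add_diff_cancel diff_add_cancel scaleC_add_right)

lemma scaleC_zero_right [simp]: "c *\<^sub>C (0::'a::complex_inner) = 0"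
  using scaleC_diff_right[of c 0 0] by simp

lemma scaleC_scaleR: "c *\<^sub>C (r *\<^sub>R x) = r *\<^sub>R (c *\<^sub>C (x::'a::complex_inner))"
  by (metis mult.commute scaleC_of_real scaleC_scaleC)

lemma cinner_add_right: "cinner x (y + z) = cinner x y + cinner x (z::'a::complex_inner)"
  using cinner_commute[of x "y + z"] cinner_commute[of x y] cinner_commute[of x z]
  by (simp add: cinner_add_left)

lemma cinner_scaleC_right: "cinner x (c *\<^sub>C y) = cnj c * cinner x (y::'a::complex_inner)"
  using cinner_commute[of x "c *\<^sub>C y"] cinner_commute[of x y] by (simp add: cinner_scaleC_left)

lemma cinner_diff_left: "cinner (x - y) z = cinner x z - cinner y (z::'a::complex_inner)"
  by (metis add_diff_cancel diff_add_cancel cinner_add_left)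

lemma cinner_diff_right: "cinner x (y - z) = cinner x y - cinner x (z::'a::complex_inner)"
  by (metis add_diff_cancel diff_add_cancel cinner_add_right)

lemma cinner_zero [simp]: "cinner 0 x = 0" "cinner x (0::'a::complex_inner) = 0"
  using cinner_diff_left[of 0 0 x] cinner_diff_right[of x 0 0] by simp_all

lemma cinner_scaleR_left: "cinner (r *\<^sub>R x) y = of_real r * cinner x (y::'a::complex_inner)"
  by (simp flip: scaleC_of_real add: cinner_scaleC_left)

lemma cinner_scaleR_right: "cinner x (r *\<^sub>R y) = of_real r * cinner x (y::'a::complex_inner)"
  by (simp flip: scaleC_of_real add: cinner_scaleC_right)

text \<open>Conjugate linearity turns the factor \<open>\<i>\<close> in the second argument into
  \<open>- \<i>\<close>, which moves the imaginary part into the real one. Continuity and symmetry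
  are inherited from the real inner product in this way.\<close>

lemma cinner_eq_inner: "cinner x y = Complex (inner x y) (inner x (\<i> *\<^sub>C (y::'a::complex_inner)))"
  by (rule complex_eqI) (simp_all flip: Re_cinner add: cinner_scaleC_right)

lemma cinner_self: "cinner x x = of_real ((norm (x::'a::complex_inner))\<^sup>2)"
proof (rule complex_eqI)
  show "Re (cinner x x) = Re (of_real ((norm x)\<^sup>2))"
    by (simp add: Re_cinner power2_norm_eq_inner)
  show "Im (cinner x x) = Im (of_real ((norm x)\<^sup>2))"
    using arg_cong[OF cinner_commute[of x x], of Im] by simp
qed

lemma cinner_ext:
  assumes "\<And>z::'a::complex_inner. cinner x z = cinner y z"
  shows "x = y"
proof -
  have "cinner (x - y) (x - y) = 0"
    using assms by (simp add: cinner_diff_left)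
  thus ?thesis
    by (simp add: cinner_self)
qed

lemma cinner_ext_right:
  assumes "\<And>z::'a::complex_inner. cinner z x = cinner z y"
  shows "x = y"
  using assms by (intro cinner_ext) (metis cinner_commute)

lemma norm_scaleC: "norm (c *\<^sub>C x) = cmod c * norm (x::'a::complex_inner)"
proof -
  have "complex_of_real ((norm (c *\<^sub>C x))\<^sup>2) = of_real ((cmod c * norm x)\<^sup>2)"
    unfolding cinner_self[symmetric] cinner_scaleC_left cinner_scaleC_right
    by (simp add: cinner_self power_mult_distrib complex_norm_square[of c, simplified] mult_ac)
  hence "(norm (c *\<^sub>C x))\<^sup>2 = (cmod c * norm x)\<^sup>2"
    unfolding of_real_eq_iff .
  thus ?thesis
    by (simp add: power2_eq_iff_nonneg)
qed

lemma bounded_linear_scaleC: "bounded_linear (\<lambda>x::'a::complex_inner. c *\<^sub>C x)"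
  by (rule bounded_linear_intro[where K = "cmod c"])
    (simp_all add: scaleC_add_right scaleC_scaleR norm_scaleC mult.commute)

lemma continuous_on_cinner [continuous_intros]:
  fixes f g :: "'a::topological_space \<Rightarrow> 'b::complex_inner"
  assumes "continuous_on X f" "continuous_on X g"
  shows "continuous_on X (\<lambda>x. cinner (f x) (g x))"
  unfolding cinner_eq_inner Complex_eq
  by (intro continuous_intros assms bounded_linear.continuous_on[OF bounded_linear_scaleC])

section \<open>Bounded operators and adjoints\<close>

lemma bounded_ops_bounded_linear: "A \<in> bounded_ops \<Longrightarrow> bounded_linear A"
  by (simp add: bounded_ops_def)

lemma bounded_ops_scaleC: "A \<in> bounded_ops \<Longrightarrow> A (c *\<^sub>C x) = c *\<^sub>C A x"
  by (simp add: bounded_ops_def)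

lemma bounded_opsI:
  "bounded_linear A \<Longrightarrow> (\<And>c x. A (c *\<^sub>C x) = c *\<^sub>C A x) \<Longrightarrow> A \<in> bounded_ops"
  by (simp add: bounded_ops_def)

lemma bounded_ops_add: "A \<in> bounded_ops \<Longrightarrow> A (x + y) = A x + A y"
  by (simp add: bounded_ops_bounded_linear linear_add bounded_linear.linear)

lemma bounded_ops_diff: "A \<in> bounded_ops \<Longrightarrow> A (x - y) = A x - A y"
  by (simp add: bounded_ops_bounded_linear linear_diff bounded_linear.linear)

lemma bounded_ops_0: "A \<in> bounded_ops \<Longrightarrow> A 0 = 0"
  by (simp add: bounded_ops_bounded_linear linear_0 bounded_linear.linear)

lemma bounded_ops_comp: "A \<in> bounded_ops \<Longrightarrow> B \<in> bounded_ops \<Longrightarrow> A \<circ> B \<in> bounded_ops"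
  unfolding bounded_ops_def
  using bounded_linear_compose[of A B] by (auto simp: o_def)

lemma bounded_ops_minus:
  "A \<in> bounded_ops \<Longrightarrow> B \<in> bounded_ops \<Longrightarrow> (\<lambda>x. A x - B x) \<in> bounded_ops"
  unfolding bounded_ops_def
  by (auto intro: bounded_linear_sub simp: scaleC_diff_right)

lemma bounded_ops_inj_iff: "A \<in> bounded_ops \<Longrightarrow> inj A \<longleftrightarrow> (\<forall>x. A x = 0 \<longrightarrow> x = 0)"
  by (simp add: linear_injective_0 bounded_ops_bounded_linear bounded_linear.linear)

lemma bounded_ops_inj_eq_0: "A \<in> bounded_ops \<Longrightarrow> inj A \<Longrightarrow> A x = 0 \<Longrightarrow> x = 0"
  using bounded_ops_inj_iff by blast

lemma bounded_ops_bound: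
  assumes "A \<in> bounded_ops"
  obtains K where "K > 0" "\<And>x. norm (A x) \<le> K * norm x"
  using bounded_linear.pos_bounded[OF bounded_ops_bounded_linear[OF assms]]
  by (auto simp: mult.commute)

text \<open>The representing vector minimizes \<open>\<parallel>x\<parallel>\<^sup>2 - 2 f x\<close>; the parallelogram law makes minimizing
  sequences Cauchy.\<close>

lemma riesz_real:
  fixes f :: "'a::{real_inner,complete_space} \<Rightarrow> real"
  assumes f: "bounded_linear f"
  shows "\<exists>y. \<forall>x. f x = inner x y"
proof -
  interpret f: bounded_linear f by (rule f)
  define q where "q x = (norm x)\<^sup>2 - 2 * f x" for x
  obtain K where K: "\<And>x. norm (f x) \<le> norm x * K" "0 \<le> K"
    using f.nonneg_bounded by auto
  have low: "q x \<ge> - K\<^sup>2" for x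
  proof -
    have "f x \<le> norm x * K" using K(1)[of x] by simp
    hence "q x + K\<^sup>2 \<ge> (norm x - K)\<^sup>2"
      by (simp add: q_def power2_diff)
    thus ?thesis using zero_le_power2[of "norm x - K"] by linarith
  qed
  define m where "m = (INF x. q x)"
  have bdd: "bdd_below (range q)"
    using low by (intro bdd_belowI2) auto
  have m_le: "m \<le> q x" for x
    unfolding m_def by (rule cINF_lower[OF bdd]) simp
  have "\<exists>x. q x < m + e" if "e > 0" for e
    using cINF_less_iff[OF _ bdd, of "m + e"] that by (auto simp: m_def)
  hence "\<exists>x. q x < m + 1 / Suc n" for n
    by simp
  then obtain x where x: "q (x n) < m + 1 / Suc n" for n
    using choice[of "\<lambda>n x. q x < m + 1 / Suc n"] by blast
  have para: "(norm (a - b))\<^sup>2 \<le> 2 * (q a - m) + 2 * (q b - m)" for a b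
  proof -
    define c where "c = (1/2) *\<^sub>R (a + b)"
    have "q c \<ge> m" by (rule m_le)
    moreover have "4 * q c + (norm (a - b))\<^sup>2 = 2 * q a + 2 * q b"
      by (simp add: c_def q_def power2_norm_eq_inner inner_simps f.scaleR f.add inner_commute
          field_simps del: norm_scaleR)
    ultimately show ?thesis by argo
  qed
  have "Cauchy x"
  proof (rule metric_CauchyI)
    fix e :: real assume e: "e > 0"
    obtain M where M: "4 / e\<^sup>2 < real (Suc M)"
      using reals_Archimedean2[of "4 / e\<^sup>2"] by (metis less_Suc_eq of_nat_less_iff order.strict_trans)
    have "dist (x i) (x j) < e" if ij: "i \<ge> M" "j \<ge> M" for i j
    proof -
      have "1 / Suc i \<le> 1 / Suc M" "1 / Suc j \<le> 1 / Suc M"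
        using ij by (simp_all add: frac_le)
      hence "(norm (x i - x j))\<^sup>2 < 4 * (1 / Suc M)"
        using para[of "x i" "x j"] x[of i] x[of j] by argo
      also have "4 * (1 / Suc M) < e\<^sup>2"
        using M e by (simp add: field_simps)
      finally show ?thesis
        using e by (simp add: dist_norm power2_less_imp_less)
    qed
    thus "\<exists>M. \<forall>m\<ge>M. \<forall>n\<ge>M. dist (x m) (x n) < e" by blast
  qed
  then obtain y where y: "x \<longlonglongrightarrow> y"
    by (meson Cauchy_convergent convergent_def)
  have "(\<lambda>n. q (x n)) \<longlonglongrightarrow> q y"
    unfolding q_def by (intro tendsto_intros f.tendsto y)
  moreover have "(\<lambda>n. m + 1 / Suc n) \<longlonglongrightarrow> m"
    using LIMSEQ_inverse_real_of_nat_add[of m] by (simp add: inverse_eq_divide)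
  ultimately have qy: "q y \<le> m"
    using x by (intro LIMSEQ_le[of _ "q y" _ m]) (auto intro: less_imp_le)
  have "f z = inner z y" for z
  proof -
    define d where "d = inner z y - f z"
    \<comment> \<open>Moving from \<open>y\<close> along \<open>- z\<close> changes \<open>q\<close>
      to first order by \<open>- 2 * t * d\<close>, so minimality must force \<open>d = 0\<close>.
      The best step would be \<open>d / (norm z)^2\<close>; the added 1 covers \<open>z = 0\<close>
      and keeps the linear term dominant.\<close>
    define t where "t = d / ((norm z)\<^sup>2 + 1)"
    have "q (y - t *\<^sub>R z) = q y - 2 * t * d + t\<^sup>2 * (norm z)\<^sup>2"
      unfolding q_def d_def power2_norm_eq_inner
      by (simp add: inner_simps f.scaleR f.diff inner_commute power2_eq_square algebra_simps)
    hence "2 * t * d \<le> t\<^sup>2 * (norm z)\<^sup>2"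
      using m_le[of "y - t *\<^sub>R z"] qy by linarith
    moreover have "d = t * ((norm z)\<^sup>2 + 1)"
      using sum_power2_gt_zero_iff[of "norm z" 1] by (simp add: t_def)
    ultimately have "2 * t\<^sup>2 * ((norm z)\<^sup>2 + 1) \<le> t\<^sup>2 * (norm z)\<^sup>2"
      by (simp add: power2_eq_square mult.assoc)
    hence "t\<^sup>2 * (norm z)\<^sup>2 + 2 * t\<^sup>2 \<le> 0"
      by (simp add: algebra_simps)
    moreover have "t\<^sup>2 * (norm z)\<^sup>2 \<ge> 0" by simp
    ultimately have "t\<^sup>2 \<le> 0" by linarith
    hence "t = 0" by simp
    thus ?thesis using \<open>d = t * _\<close> by (simp add: d_def)
  qed
  thus ?thesis by blast
qed

lemma adj_eqI:
  assumes "\<And>x y. cinner (A x) y = cinner x (B y)"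
  shows "adj A = B"
  unfolding adj_def
proof (rule the_equality)
  show "\<forall>x y. cinner (A x) y = cinner x (B y)" using assms by blast
  show "C = B" if "\<forall>x y. cinner (A x) y = cinner x (C y)" for C
    using that assms by (intro ext cinner_ext_right) metis
qed

text \<open>The real Riesz theorem represents only the real part of \<open>cinner (A x) y\<close>;
  complex homogeneity of \<open>A\<close>, used at \<open>\<i> *\<^sub>C x\<close>, recovers the
  imaginary part.\<close>

lemma cinner_adj_left:
  fixes A :: "'a::chilbert \<Rightarrow> 'b::complex_inner"
  assumes A: "A \<in> bounded_ops"
  shows "cinner (A x) y = cinner x (adj A y)"
proof -
  have "\<exists>z. \<forall>x. inner (A x) y = inner x z" for y
    by (intro riesz_real bounded_linear_compose[OF bounded_linear_inner_left]
        bounded_ops_bounded_linear[OF A])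
  then obtain B where B: "\<And>x y. inner (A x) y = inner x (B y)"
    by metis
  have "cinner (A x) y = cinner x (B y)" for x y
  proof (rule complex_eqI)
    show "Re (cinner (A x) y) = Re (cinner x (B y))"
      by (simp add: Re_cinner B)
    have "Re (cinner (A (\<i> *\<^sub>C x)) y) = Re (cinner (\<i> *\<^sub>C x) (B y))"
      by (simp add: Re_cinner B)
    thus "Im (cinner (A x) y) = Im (cinner x (B y))"
      by (simp add: bounded_ops_scaleC[OF A] cinner_scaleC_left)
  qed
  thus ?thesis
    using adj_eqI[of A B] by metis
qed

lemma cinner_adj_right:
  fixes A :: "'a::chilbert \<Rightarrow> 'b::complex_inner"
  shows "A \<in> bounded_ops \<Longrightarrow> cinner x (A y) = cinner (adj A x) y"
  by (metis cinner_adj_left cinner_commute)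

lemma adj_bounded_ops:
  fixes A :: "'a::chilbert \<Rightarrow> 'b::complex_inner"
  assumes A: "A \<in> bounded_ops"
  shows "adj A \<in> bounded_ops"
proof -
  obtain K where K: "K > 0" "\<And>x. norm (A x) \<le> K * norm x"
    using bounded_ops_bound[OF A] by blast
  note adj = cinner_adj_left[OF A, symmetric]
  have scaleC: "adj A (c *\<^sub>C x) = c *\<^sub>C adj A x" for c x
    by (rule cinner_ext_right) (simp add: adj cinner_scaleC_right)
  have bound: "norm (adj A y) \<le> norm y * K" for y
  proof -
    have "(norm (adj A y))\<^sup>2 = inner (A (adj A y)) y"
      by (simp flip: Re_cinner add: adj[symmetric] cinner_self)
    also have "\<dots> \<le> norm (A (adj A y)) * norm y"
      by (rule norm_cauchy_schwarz)
    also have "\<dots> \<le> K * norm (adj A y) * norm y"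
      by (intro mult_right_mono K norm_ge_zero)
    finally show ?thesis
      by (cases "norm (adj A y) = 0") (use K in \<open>simp_all add: power2_eq_square mult_ac\<close>)
  qed
  show ?thesis
  proof (rule bounded_opsI[OF bounded_linear_intro[OF _ _ bound] scaleC])
    show "adj A (x + y) = adj A x + adj A y" for x y
      by (rule cinner_ext_right) (simp add: adj cinner_add_right)
    show "adj A (r *\<^sub>R x) = r *\<^sub>R adj A x" for r x
      using scaleC[of "of_real r" x] by (simp add: scaleC_of_real)
  qed
qed

lemma adj_adj:
  fixes A :: "'a::chilbert \<Rightarrow> 'b::complex_inner"
  shows "A \<in> bounded_ops \<Longrightarrow> adj (adj A) = A"
  by (intro adj_eqI) (simp add: cinner_adj_right)

lemma adj_comp:
  fixes A :: "'b::chilbert \<Rightarrow> 'c::complex_inner" and B :: "'a::chilbert \<Rightarrow> 'b"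
  shows "A \<in> bounded_ops \<Longrightarrow> B \<in> bounded_ops \<Longrightarrow> adj (A \<circ> B) = adj B \<circ> adj A"
  by (intro adj_eqI) (simp add: cinner_adj_left)

lemma isometry_bounded_ops: "isometry V \<Longrightarrow> V \<in> bounded_ops"
  by (simp add: isometry_def)

lemma isometry_norm: "isometry V \<Longrightarrow> norm (V x) = norm x"
  by (simp add: isometry_def)

lemma isometry_iff_adj_comp:
  fixes V :: "'a::chilbert \<Rightarrow> 'b::complex_inner"
  assumes V: "V \<in> bounded_ops"
  shows "isometry V \<longleftrightarrow> adj V \<circ> V = id"
proof
  assume iso: "isometry V"
  \<comment> \<open>\<open>dot_norm\<close> is polarization: norms determine the real inner product,
    and \<open>\<i> *\<^sub>C x\<close> in place of \<open>x\<close> gives the imaginary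
    part.\<close>
  have re: "Re (cinner (V x) (V y)) = Re (cinner x y)" for x y
    by (simp add: Re_cinner dot_norm isometry_norm[OF iso] flip: bounded_ops_add[OF V])
  have "cinner (V x) (V y) = cinner x y" for x y
    using re[of x y] re[of "\<i> *\<^sub>C x" y]
    by (simp add: complex_eqI bounded_ops_scaleC[OF V] cinner_scaleC_left)
  thus "adj V \<circ> V = id"
    by (intro ext cinner_ext_right) (simp flip: cinner_adj_left[OF V])
next
  assume "adj V \<circ> V = id"
  hence "adj V (V x) = x" for x
    by (metis comp_apply id_apply)
  hence "cinner (V x) (V x) = cinner x x" for x
    by (simp add: cinner_adj_left[OF V])
  hence "(norm (V x))\<^sup>2 = (norm x)\<^sup>2" for x
    unfolding cinner_self of_real_eq_iff .
  thus "isometry V"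
    using V by (simp add: isometry_def power2_eq_iff_nonneg)
qed

lemma isometry_adj_apply:
  fixes V :: "'a::chilbert \<Rightarrow> 'b::complex_inner"
  assumes "isometry V"
  shows "adj V (V x) = x"
  using assms isometry_iff_adj_comp[of V] by (simp add: isometry_def fun_eq_iff)

lemma isometry_eq_iff: "isometry V \<Longrightarrow> V x = V y \<longleftrightarrow> x = y"
  using isometry_norm[of V "x - y"] bounded_ops_diff[of V x y]
  by (auto simp: isometry_bounded_ops)

text \<open>Since \<open>adj j (j h) = h\<close>, the map \<open>adj j\<close> annihilates
  \<open>x - j (adj j x)\<close>. The explicit formula turns the commutant condition in
  \<open>is_lift\<close> into an identity between \<open>j\<close>, \<open>adj j\<close> and the
  lift.\<close>

lemma ortho_proj_range_isometry:
  fixes j :: "'a::chilbert \<Rightarrow> 'b::complex_inner"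
  assumes j: "isometry j"
  shows "ortho_proj (range j) = j \<circ> adj j"
proof
  fix x
  note jb = isometry_bounded_ops[OF j]
  show "ortho_proj (range j) x = (j \<circ> adj j) x"
    unfolding ortho_proj_def
  proof (rule the_equality)
    show "(j \<circ> adj j) x \<in> range j \<and> x - (j \<circ> adj j) x \<in> ortho_compl (range j)"
      by (auto simp: ortho_compl_def cinner_adj_right[OF jb] isometry_adj_apply[OF j]
          bounded_ops_diff[OF adj_bounded_ops[OF jb]])
  next
    fix y assume y: "y \<in> range j \<and> x - y \<in> ortho_compl (range j)"
    then obtain h where h: "y = j h" by blast
    have "cinner (adj j x - h) z = 0" for z
      using y by (simp add: ortho_compl_def h cinner_adj_right[OF jb] isometry_adj_apply[OF j]
          bounded_ops_diff[OF adj_bounded_ops[OF jb]])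
    hence "adj j x = h"
      by (metis cinner_ext cinner_zero(1) right_minus_eq)
    thus "y = (j \<circ> adj j) x"
      by (simp add: h)
  qed
qed

section \<open>Positive square roots\<close>

instance chilbert \<subseteq> banach ..

text \<open>For \<open>\<parallel>T\<parallel> \<le> 1\<close> the iterates converge to a solution \<open>X\<close> of \<open>X = (T + X\<^sup>2) / 2\<close>, so that
  \<open>(I - X)\<^sup>2 = I - T\<close>. The scalar iteration with \<open>T = 1\<close> majorizes the operator iteration.\<close>

primrec sqrt_iter :: "('a::real_normed_vector \<Rightarrow>\<^sub>L 'a) \<Rightarrow> nat \<Rightarrow> 'a \<Rightarrow>\<^sub>L 'a" where
  "sqrt_iter T 0 = 0"
| "sqrt_iter T (Suc n) = (1/2) *\<^sub>R (T + (sqrt_iter T n o\<^sub>L sqrt_iter T n))"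

primrec sqrt_bound :: "nat \<Rightarrow> real" where
  "sqrt_bound 0 = 0"
| "sqrt_bound (Suc n) = (1 + (sqrt_bound n)\<^sup>2) / 2"

lemma sqrt_bound_range: "0 \<le> sqrt_bound n \<and> sqrt_bound n \<le> 1"
proof (induction n)
  case (Suc n)
  hence "(sqrt_bound n)\<^sup>2 \<le> 1" by (simp add: power_le_one)
  thus ?case by simp
qed simp

lemma sqrt_bound_mono: "sqrt_bound n \<le> sqrt_bound (Suc n)"
  using zero_le_power2[of "1 - sqrt_bound n"] by (simp add: power2_diff)

text \<open>Each iterate is a polynomial in \<open>T\<close>. Applied with \<open>C\<close> equal to
  \<open>T\<close> and then to an iterate, this also shows that successive iterates commute.\<close>

lemma sqrt_iter_commute:
  assumes "\<And>x. blinfun_apply T (blinfun_apply C x) = blinfun_apply C (blinfun_apply T x)"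
  shows "blinfun_apply (sqrt_iter T n) (blinfun_apply C x) =
    blinfun_apply C (blinfun_apply (sqrt_iter T n) x)"
proof (induction n arbitrary: x)
  case (Suc n)
  show ?case
    by (simp add: blinfun.add_left blinfun.add_right blinfun.scaleR_left blinfun.scaleR_right
        Suc.IH assms)
qed simp

lemma norm_sqrt_iter: "norm T \<le> 1 \<Longrightarrow> norm (sqrt_iter T n) \<le> sqrt_bound n"
proof (induction n)
  case (Suc n)
  have "norm (sqrt_iter T n o\<^sub>L sqrt_iter T n) \<le> norm (sqrt_iter T n) * norm (sqrt_iter T n)"
    by (rule norm_blinfun_compose)
  also have "\<dots> \<le> (sqrt_bound n)\<^sup>2"
    unfolding power2_eq_square using Suc sqrt_bound_range[of n] by (intro mult_mono) auto
  finally show ?case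
    using norm_triangle_ineq[of T "sqrt_iter T n o\<^sub>L sqrt_iter T n"] Suc.prems by simp
qed simp

text \<open>As \<open>?X\<close> and \<open>?Y\<close> commute, the difference of their squares
  factors as \<open>(?Y + ?X) o\<^sub>L (?Y - ?X)\<close>. The scalar recurrence factors in the same
  way with equality, so the bound propagates.\<close>

lemma norm_sqrt_iter_diff:
  assumes "norm T \<le> 1"
  shows "norm (sqrt_iter T (Suc n) - sqrt_iter T n) \<le> sqrt_bound (Suc n) - sqrt_bound n"
proof (induction n)
  case 0
  show ?case using assms by simp
next
  case (Suc n)
  let ?X = "sqrt_iter T n" and ?Y = "sqrt_iter T (Suc n)"
  have XT: "blinfun_apply T (blinfun_apply ?X x) = blinfun_apply ?X (blinfun_apply T x)" for x
    by (rule sqrt_iter_commute[symmetric]) simp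
  have comm: "blinfun_apply ?Y (blinfun_apply ?X x) = blinfun_apply ?X (blinfun_apply ?Y x)" for x
    by (rule sqrt_iter_commute[OF XT])
  have "sqrt_iter T (Suc (Suc n)) - ?Y = (1/2) *\<^sub>R ((?Y o\<^sub>L ?Y) - (?X o\<^sub>L ?X))"
    unfolding sqrt_iter.simps(2)[of T "Suc n"]
    by (subst (3) sqrt_iter.simps(2)) (simp only: scaleR_diff_right[symmetric] add_diff_cancel_left)
  also have "(?Y o\<^sub>L ?Y) - (?X o\<^sub>L ?X) = (?Y + ?X) o\<^sub>L (?Y - ?X)"
    by (rule blinfun_eqI)
      (simp add: blinfun.add_left blinfun.diff_left blinfun.diff_right comm del: sqrt_iter.simps)
  finally have "norm (sqrt_iter T (Suc (Suc n)) - ?Y) = norm ((?Y + ?X) o\<^sub>L (?Y - ?X)) / 2"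
    by simp
  also have "norm ((?Y + ?X) o\<^sub>L (?Y - ?X)) \<le> norm (?Y + ?X) * norm (?Y - ?X)"
    by (rule norm_blinfun_compose)
  also have "\<dots> \<le> (sqrt_bound (Suc n) + sqrt_bound n) * (sqrt_bound (Suc n) - sqrt_bound n)"
    using norm_sqrt_iter[OF assms, of n] norm_sqrt_iter[OF assms, of "Suc n"]
      sqrt_bound_range[of n] sqrt_bound_range[of "Suc n"]
    by (intro mult_mono Suc.IH norm_triangle_le) (auto simp del: sqrt_iter.simps sqrt_bound.simps)
  also have "\<dots> = 2 * (sqrt_bound (Suc (Suc n)) - sqrt_bound (Suc n))"
    by (simp add: power2_eq_square field_simps)
  finally show ?case by (simp del: sqrt_iter.simps sqrt_bound.simps)
qed

text \<open>The increments are dominated by those of a bounded increasing scalar sequence, whose sum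
  telescopes; hence they are absolutely summable.\<close>

lemma sqrt_iter_converges:
  fixes T :: "'a::banach \<Rightarrow>\<^sub>L 'a"
  assumes T: "norm T \<le> 1"
  obtains X where "sqrt_iter T \<longlonglongrightarrow> X"
proof -
  have "convergent sqrt_bound"
    using sqrt_bound_mono sqrt_bound_range
    by (intro Bseq_mono_convergent BseqI'[of _ 1]) (auto intro: lift_Suc_mono_le[of sqrt_bound])
  hence "summable (\<lambda>n. sqrt_bound (Suc n) - sqrt_bound n)"
    unfolding convergent_def by (blast intro: sums_summable telescope_sums)
  hence "summable (\<lambda>n. norm (sqrt_iter T (Suc n) - sqrt_iter T n))"
    by (rule summable_comparison_test_ev[rotated])
      (use norm_sqrt_iter_diff[OF T] in \<open>simp del: sqrt_iter.simps sqrt_bound.simps\<close>)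
  hence "summable (\<lambda>n. sqrt_iter T (Suc n) - sqrt_iter T n)"
    by (rule summable_norm_cancel)
  hence "convergent (\<lambda>n. \<Sum>i<n. sqrt_iter T (Suc i) - sqrt_iter T i)"
    by (simp only: summable_iff_convergent)
  \<comment> \<open>The partial sums are the iterates themselves because the iteration starts at
    0.\<close>
  hence "convergent (sqrt_iter T)"
    by (simp add: sum_lessThan_telescope del: sqrt_iter.simps(2))
  thus ?thesis
    using that by (auto simp: convergent_def)
qed

text \<open>The form of \<open>A\<close> is nonnegative at \<open>x - t *\<^sub>R A x\<close>, and
  its value there is at most \<open>inner (A x) x - 2 * t * (norm (A x))^2 + t^2 * K * (norm (A
  x))^2\<close>; the choice \<open>t = 1/K\<close> minimizes this bound.\<close>

lemma positive_norm_bound: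
  fixes A :: "'a::real_inner \<Rightarrow> 'a"
  assumes A: "linear A" and sym: "\<And>x y. inner (A x) y = inner x (A y)"
    and pos: "\<And>x. inner (A x) x \<ge> 0" and K: "K > 0" "\<And>x. norm (A x) \<le> K * norm x"
  shows "(norm (A x))\<^sup>2 \<le> K * inner (A x) x"
proof -
  define y where "y = x - (1/K) *\<^sub>R A x"
  have "inner (A y) y = inner (A x) x - 2 / K * (norm (A x))\<^sup>2 + 1 / K\<^sup>2 * inner (A (A x)) (A x)"
    unfolding y_def power2_norm_eq_inner
    by (simp add: linear_diff[OF A] linear_scale[OF A] inner_simps sym power2_eq_square
        algebra_simps)
  moreover have "inner (A (A x)) (A x) \<le> norm (A (A x)) * norm (A x)"
    by (rule norm_cauchy_schwarz)
  hence "inner (A (A x)) (A x) \<le> K * (norm (A x))\<^sup>2"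
    unfolding power2_eq_square mult.assoc[symmetric]
    by (rule order_trans) (intro mult_right_mono K norm_ge_zero)
  hence "1 / K\<^sup>2 * inner (A (A x)) (A x) \<le> 1 / K\<^sup>2 * (K * (norm (A x))\<^sup>2)"
    by (intro mult_left_mono) auto
  ultimately have "0 \<le> inner (A x) x - 2 / K * (norm (A x))\<^sup>2 + 1 / K\<^sup>2 * (K * (norm (A x))\<^sup>2)"
    using pos[of y] by argo
  also have "\<dots> = inner (A x) x - (norm (A x))\<^sup>2 / K"
    using K(1) by (simp add: field_simps power2_eq_square)
  finally show ?thesis
    using K(1) by (simp add: field_simps)
qed

text \<open>Commutation is claimed for all real linear bounded \<open>C\<close>, so that
  multiplication by a complex scalar is admissible later.\<close>

lemma positive_sqrt_real:
  fixes A :: "'a::{real_inner,banach} \<Rightarrow> 'a"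
  assumes A: "bounded_linear A" and sym: "\<And>x y. inner (A x) y = inner x (A y)"
    and pos: "\<And>x. inner (A x) x \<ge> 0"
  shows "\<exists>R. bounded_linear R \<and> (\<forall>x y. inner (R x) y = inner x (R y)) \<and>
    (\<forall>x. inner (R x) x \<ge> 0) \<and> (\<forall>x. R (R x) = A x) \<and>
    (\<forall>C. bounded_linear C \<longrightarrow> (\<forall>x. C (A x) = A (C x)) \<longrightarrow> (\<forall>x. C (R x) = R (C x)))"
proof -
  note lin = bounded_linear.linear[OF A]
  obtain K where K: "K > 0" "\<And>x. norm (A x) \<le> K * norm x"
    using bounded_linear.pos_bounded[OF A] by (auto simp: mult.commute)
  \<comment> \<open>Here \<open>I - T = A / K\<close>, and \<open>T\<close> is a contraction by the
    preceding bound. The iteration gives \<open>X\<close> with \<open>(I - X)^2 = A / K\<close>,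
    which explains the factor \<open>sqrt K\<close> in \<open>R\<close>.\<close>
  define T where "T = Blinfun (\<lambda>x. x - (1/K) *\<^sub>R A x)"
  have T: "blinfun_apply T x = x - (1/K) *\<^sub>R A x" for x
    unfolding T_def
    by (simp add: bounded_linear_Blinfun_apply bounded_linear_sub bounded_linear_ident
        bounded_linear_const_scaleR A)
  have "norm (blinfun_apply T x) \<le> 1 * norm x" for x
  proof -
    have "(norm (blinfun_apply T x))\<^sup>2 = (norm x)\<^sup>2 - 2 / K * inner (A x) x + (norm (A x))\<^sup>2 / K\<^sup>2"
      unfolding T power2_norm_eq_inner
      by (simp add: inner_simps inner_commute power2_eq_square algebra_simps)
    also have "(norm (A x))\<^sup>2 / K\<^sup>2 \<le> K * inner (A x) x / K\<^sup>2"
      by (intro divide_right_mono positive_norm_bound[OF lin sym pos K]) simp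
    also have "\<dots> = 1 / K * inner (A x) x"
      by (simp add: power2_eq_square)
    also have "(norm x)\<^sup>2 - 2 / K * inner (A x) x + 1 / K * inner (A x) x
        = (norm x)\<^sup>2 - 1 / K * inner (A x) x"
      by (simp add: field_simps)
    also have "\<dots> \<le> (norm x)\<^sup>2"
      using K(1) pos[of x] by simp
    finally show ?thesis by (simp add: power2_le_iff_abs_le)
  qed
  hence nT: "norm T \<le> 1" by (intro norm_blinfun_bound) auto
  obtain X where X: "sqrt_iter T \<longlonglongrightarrow> X"
    by (rule sqrt_iter_converges[OF nT])
  have Xx: "(\<lambda>n. blinfun_apply (sqrt_iter T n) x) \<longlonglongrightarrow> blinfun_apply X x" for x
    by (intro tendsto_intros X)
  have "norm (sqrt_iter T n) \<le> 1" for n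
    using norm_sqrt_iter[OF nT, of n] sqrt_bound_range[of n] by simp
  \<comment> \<open>Contractivity of the limit is what makes \<open>I - X\<close> positive.\<close>
  hence nX: "norm X \<le> 1"
    by (intro LIMSEQ_le_const2[OF tendsto_norm[OF X]]) auto
  have "(\<lambda>n. sqrt_iter T (Suc n)) \<longlonglongrightarrow> (1/2) *\<^sub>R (T + (X o\<^sub>L X))"
    unfolding sqrt_iter.simps by (intro tendsto_intros X)
  hence "X = (1/2) *\<^sub>R (T + (X o\<^sub>L X))"
    using LIMSEQ_Suc[OF X] LIMSEQ_unique by blast
  hence "2 *\<^sub>R X = 2 *\<^sub>R (1/2) *\<^sub>R (T + (X o\<^sub>L X))"
    by (rule arg_cong)
  hence "X o\<^sub>L X = 2 *\<^sub>R X - T"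
    by (simp add: algebra_simps)
  hence "blinfun_apply (X o\<^sub>L X) x = blinfun_apply (2 *\<^sub>R X - T) x" for x
    by (rule arg_cong)
  hence fix_X: "blinfun_apply X (blinfun_apply X x) = 2 *\<^sub>R blinfun_apply X x - blinfun_apply T x" for x
    by (simp add: blinfun.diff_left blinfun.scaleR_left)
  have sym_iter: "inner (blinfun_apply (sqrt_iter T n) x) y = inner x (blinfun_apply (sqrt_iter T n) y)"
    for n x y
  proof (induction n arbitrary: x y)
    case (Suc n)
    show ?case
      by (simp add: blinfun.add_left blinfun.scaleR_left inner_simps Suc.IH T sym)
  qed simp
  have sym_X: "inner (blinfun_apply X x) y = inner x (blinfun_apply X y)" for x y
    by (rule LIMSEQ_unique[OF tendsto_inner[OF Xx tendsto_const]])
      (unfold sym_iter, intro tendsto_intros Xx)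
  define R where "R x = sqrt K *\<^sub>R (x - blinfun_apply X x)" for x
  show ?thesis
  proof (intro exI conjI allI impI)
    show R: "bounded_linear R"
      unfolding R_def
      by (intro bounded_linear_const_scaleR bounded_linear_sub bounded_linear_ident
          blinfun.bounded_linear_right)
    show "inner (R x) y = inner x (R y)" for x y
      by (simp add: R_def inner_simps sym_X)
    show "inner (R x) x \<ge> 0" for x
    proof -
      have "inner (blinfun_apply X x) x \<le> norm (blinfun_apply X x) * norm x"
        by (rule norm_cauchy_schwarz)
      also have "\<dots> \<le> norm x * norm x"
        using norm_blinfun[of X x] nX mult_right_mono[OF nX, of "norm x"]
        by (intro mult_right_mono) auto
      finally have "inner (blinfun_apply X x) x \<le> inner x x"
        by (simp add: power2_norm_eq_inner flip: power2_eq_square)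
      thus ?thesis
        using K(1) by (simp add: R_def inner_simps)
    qed
    show "R (R x) = A x" for x
    proof -
      have "R (R x) = (sqrt K * sqrt K) *\<^sub>R (x - 2 *\<^sub>R blinfun_apply X x + blinfun_apply X (blinfun_apply X x))"
        by (simp add: R_def blinfun.diff_right blinfun.scaleR_right algebra_simps scaleR_2)
      also have "\<dots> = A x"
        using K(1) by (simp add: fix_X T)
      finally show ?thesis .
    qed
    show "C (R x) = R (C x)" if C: "bounded_linear C" and comm: "\<forall>x. C (A x) = A (C x)" for C x
    proof -
      note linC = bounded_linear.linear[OF C]
      have "(\<lambda>n. blinfun_apply (sqrt_iter T n) (C x)) \<longlonglongrightarrow> C (blinfun_apply X x)"
        using sqrt_iter_commute[of T "Blinfun C"] bounded_linear.tendsto[OF C Xx[of x]]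
        by (simp add: bounded_linear_Blinfun_apply[OF C] T linear_diff[OF linC]
            linear_scale[OF linC] comm)
      hence "blinfun_apply X (C x) = C (blinfun_apply X x)"
        using LIMSEQ_unique Xx by blast
      thus ?thesis
        by (simp add: R_def linear_diff[OF linC] linear_scale[OF linC])
    qed
  qed
qed

section \<open>The modulus and the polar decomposition\<close>

lemma positive_op_bounded_ops: "positive_op A \<Longrightarrow> A \<in> bounded_ops"
  by (simp add: positive_op_def)

text \<open>Complex polarization: the sesquilinear defect \<open>D\<close> vanishes on the diagonal
  because the form is real there. Expanding at \<open>x + y\<close> and at
  \<open>\<i> *\<^sub>C x + y\<close> kills both the sum and the difference of \<open>D x y\<close>
  and \<open>D y x\<close>.\<close>

lemma positive_op_symmetric:
  assumes A: "positive_op A"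
  shows "cinner (A x) y = cinner x (A y)"
proof -
  note Ab = positive_op_bounded_ops[OF A]
  define D where "D x y = cinner (A x) y - cinner x (A y)" for x y
  have diag: "D x x = 0" for x
  proof -
    have "Im (cinner (A x) x) = 0"
      using A by (simp add: positive_op_def complex_nonneg_Reals_iff)
    thus ?thesis
      using cinner_commute[of x "A x"] by (simp add: D_def complex_eq_iff)
  qed
  have add: "D (x + y) (x + y) = D x x + D x y + D y x + D y y" for x y
    by (simp add: D_def bounded_ops_add[OF Ab] cinner_add_left cinner_add_right)
  have i: "D (\<i> *\<^sub>C x) y = \<i> * D x y" "D y (\<i> *\<^sub>C x) = - \<i> * D y x"
    by (simp_all add: D_def bounded_ops_scaleC[OF Ab] cinner_scaleC_left cinner_scaleC_right
        algebra_simps)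
  have "D x y + D y x = 0"
    using add[of x y] diag by simp
  moreover have "\<i> * D x y - \<i> * D y x = 0"
    using add[of "\<i> *\<^sub>C x" y] diag i by simp
  hence "D x y = D y x" by simp
  ultimately show ?thesis
    by (simp add: D_def)
qed

lemma adj_positive_op: "positive_op A \<Longrightarrow> adj A = A"
  by (intro adj_eqI positive_op_symmetric)

lemma positive_op_inner_ge_0: "positive_op A \<Longrightarrow> inner (A x) x \<ge> 0"
  by (simp add: positive_op_def complex_nonneg_Reals_iff flip: Re_cinner)

lemma positive_opI:
  assumes "A \<in> bounded_ops" "\<And>x y. cinner (A x) y = cinner x (A y)" "\<And>x. inner (A x) x \<ge> 0"
  shows "positive_op A"
  unfolding positive_op_def
proof (intro conjI allI assms(1))
  fix x
  have "cinner (A x) x = cnj (cinner (A x) x)"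
    using assms(2)[of x x] cinner_commute[of "A x" x] by simp
  thus "cinner (A x) x \<in> \<real>\<^sub>\<ge>\<^sub>0"
    using assms(3)[of x] by (simp add: complex_nonneg_Reals_iff Re_cinner complex_eq_iff)
qed

lemma positive_op_eq_0:
  assumes A: "positive_op A" and "inner (A x) x = 0"
  shows "A x = 0"
proof -
  note Ab = positive_op_bounded_ops[OF A]
  obtain K where K: "K > 0" "\<And>x. norm (A x) \<le> K * norm x"
    using bounded_ops_bound[OF Ab] by blast
  have "inner (A x) y = inner x (A y)" for x y
    by (simp flip: Re_cinner add: positive_op_symmetric[OF A])
  from positive_norm_bound[OF bounded_linear.linear[OF bounded_ops_bounded_linear[OF Ab]] this
      positive_op_inner_ge_0[OF A] K, of x]
  show ?thesis
    using assms(2) by simp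
qed

lemma positive_op_sqrt_exists:
  fixes A :: "'a::chilbert \<Rightarrow> 'a"
  assumes A: "positive_op A"
  shows "\<exists>R. positive_op R \<and> R \<circ> R = A \<and>
    (\<forall>C\<in>bounded_ops. C \<circ> A = A \<circ> C \<longrightarrow> C \<circ> R = R \<circ> C)"
proof -
  note Ab = positive_op_bounded_ops[OF A]
  have sym: "inner (A x) y = inner x (A y)" for x y
    by (simp flip: Re_cinner add: positive_op_symmetric[OF A])
  obtain R where R: "bounded_linear R" "\<forall>x y. inner (R x) y = inner x (R y)"
    "\<forall>x. inner (R x) x \<ge> 0" "\<forall>x. R (R x) = A x"
    and comm: "\<forall>C. bounded_linear C \<longrightarrow> (\<forall>x. C (A x) = A (C x)) \<longrightarrow> (\<forall>x. C (R x) = R (C x))"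
    using positive_sqrt_real[OF bounded_ops_bounded_linear[OF Ab] sym positive_op_inner_ge_0[OF A]]
    by (elim exE conjE) (rule that; assumption)
  \<comment> \<open>The real root is complex linear because \<open>A\<close> commutes with
    multiplication by \<open>c\<close>.\<close>
  have scaleC: "R (c *\<^sub>C x) = c *\<^sub>C R x" for c x
    using comm[rule_format, OF bounded_linear_scaleC[of c], of x]
    by (simp add: bounded_ops_scaleC[OF Ab])
  have "cinner (R x) y = cinner x (R y)" for x y
    by (simp add: cinner_eq_inner R(2) scaleC[symmetric])
  hence "positive_op R"
    using R scaleC by (intro positive_opI bounded_opsI) auto
  moreover have "C \<circ> R = R \<circ> C" if "C \<in> bounded_ops" "C \<circ> A = A \<circ> C" for C
  proof -
    have "\<forall>x. C (A x) = A (C x)"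
      using that(2) by (simp add: fun_eq_iff)
    hence "\<forall>x. C (R x) = R (C x)"
      using comm bounded_ops_bounded_linear[OF that(1)] by blast
    thus ?thesis by (simp add: fun_eq_iff)
  qed
  moreover have "R \<circ> R = A"
    using R(4) by (simp add: fun_eq_iff)
  ultimately show ?thesis
    by blast
qed

text \<open>By commutation \<open>P + Q\<close> annihilates \<open>y = P x - Q x\<close>. Both forms
  are nonnegative, so \<open>P y\<close> and \<open>Q y\<close> vanish separately, and
  \<open>cinner y y\<close> is the inner product of \<open>x\<close> with
  \<open>P y - Q y\<close>.\<close>

lemma commuting_positive_op_square_eq:
  assumes P: "positive_op P" and Q: "positive_op Q" and comm: "P \<circ> Q = Q \<circ> P"
    and sq: "P \<circ> P = Q \<circ> Q"
  shows "P = Q"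
proof
  fix x
  define y where "y = P x - Q x"
  note diff = bounded_ops_diff[OF positive_op_bounded_ops[OF P]]
    bounded_ops_diff[OF positive_op_bounded_ops[OF Q]]
  have "P y + Q y = 0"
    using fun_cong[OF comm, of x] fun_cong[OF sq, of x] by (simp add: y_def diff)
  hence "inner (P y + Q y) y = 0" by simp
  hence "inner (P y) y = 0" "inner (Q y) y = 0"
    using positive_op_inner_ge_0[OF P, of y] positive_op_inner_ge_0[OF Q, of y]
    by (simp_all add: inner_add_left add_nonneg_eq_0_iff)
  hence "P y = 0" "Q y = 0"
    using positive_op_eq_0[OF P] positive_op_eq_0[OF Q] by blast+
  hence "cinner (P x - Q x) y = 0"
    by (simp add: cinner_diff_left positive_op_symmetric[OF P] positive_op_symmetric[OF Q])
  hence "cinner y y = 0"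
    by (simp add: y_def)
  thus "P x = Q x"
    by (simp add: cinner_self y_def)
qed

text \<open>The constructed root \<open>P\<close> commutes with whatever commutes with
  \<open>A\<close>, in particular with any other positive root \<open>Q\<close>, so the commuting
  case of uniqueness suffices.\<close>

lemma sqrt_op_eqI:
  fixes R :: "'a::chilbert \<Rightarrow> 'a"
  assumes R: "positive_op R" and sq: "R \<circ> R = A"
  shows "sqrt_op A = R"
  unfolding sqrt_op_def
proof (rule the_equality)
  show "positive_op R \<and> R \<circ> R = A" using assms by blast
  have "inner (R (R x)) x \<ge> 0" for x
    by (simp flip: Re_cinner add: positive_op_symmetric[OF R] cinner_self)
  hence "positive_op A"
    unfolding sq[symmetric]
    by (intro positive_opI bounded_ops_comp positive_op_bounded_ops[OF R])
      (simp_all add: positive_op_symmetric[OF R])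
  from positive_op_sqrt_exists[OF this] obtain P where P: "positive_op P" "P \<circ> P = A"
    and comm: "\<forall>C\<in>bounded_ops. C \<circ> A = A \<circ> C \<longrightarrow> C \<circ> P = P \<circ> C"
    by (elim exE conjE) (rule that; assumption)
  have eq: "P = Q" if "positive_op Q" "Q \<circ> Q = A" for Q
  proof (rule commuting_positive_op_square_eq[OF P(1) that(1)])
    have "Q \<circ> A = A \<circ> Q"
      unfolding that(2)[symmetric] by (rule o_assoc)
    from comm[rule_format, OF positive_op_bounded_ops[OF that(1)] this] show "P \<circ> Q = Q \<circ> P" ..
    show "P \<circ> P = Q \<circ> Q" using P(2) that(2) by simp
  qed
  show "Q = R" if "positive_op Q \<and> Q \<circ> Q = A" for Q
    using eq[of Q] eq[OF assms] that by simp
qed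

context
  fixes E :: "'a::chilbert \<Rightarrow> 'b::complex_inner"
  assumes E: "E \<in> bounded_ops"
begin

text \<open>The three facts are proved together: the constructed root is identified once with the
  definite description, and its commutation property is then read off.\<close>

lemma positive_op_abs_op: "positive_op (abs_op E)"
  and abs_op_comp_self: "abs_op E \<circ> abs_op E = adj E \<circ> E"
  and abs_op_commute:
    "C \<in> bounded_ops \<Longrightarrow> C \<circ> adj E \<circ> E = adj E \<circ> E \<circ> C \<Longrightarrow> C \<circ> abs_op E = abs_op E \<circ> C"
proof -
  have "inner (adj E (E x)) x \<ge> 0" for x
    by (simp flip: Re_cinner cinner_adj_right[OF E] add: cinner_self)
  hence "positive_op (adj E \<circ> E)"
    by (intro positive_opI bounded_ops_comp adj_bounded_ops E)
      (simp_all add: cinner_adj_left[OF E] flip: cinner_adj_right[OF E])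
  from positive_op_sqrt_exists[OF this] obtain R where R: "positive_op R" "R \<circ> R = adj E \<circ> E"
    and comm: "\<forall>C\<in>bounded_ops. C \<circ> (adj E \<circ> E) = adj E \<circ> E \<circ> C \<longrightarrow> C \<circ> R = R \<circ> C"
    by (elim exE conjE) (rule that; assumption)
  have abs: "abs_op E = R"
    unfolding abs_op_def by (rule sqrt_op_eqI[OF R])
  show "positive_op (abs_op E)" "abs_op E \<circ> abs_op E = adj E \<circ> E"
    unfolding abs by (rule R)+
  show "C \<circ> abs_op E = abs_op E \<circ> C"
    if "C \<in> bounded_ops" "C \<circ> adj E \<circ> E = adj E \<circ> E \<circ> C" for C
    unfolding abs by (rule comm[rule_format, OF that(1)]) (use that(2) in \<open>simp add: o_assoc\<close>)
qed

lemma abs_op_square: "abs_op E (abs_op E x) = adj E (E x)"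
  using fun_cong[OF abs_op_comp_self, of x] by simp

lemma norm_abs_op: "norm (abs_op E x) = norm (E x)"
proof -
  have "cinner (abs_op E x) (abs_op E x) = cinner (E x) (E x)"
    by (simp add: positive_op_symmetric[OF positive_op_abs_op] abs_op_square cinner_adj_left[OF E])
  hence "(norm (abs_op E x))\<^sup>2 = (norm (E x))\<^sup>2"
    unfolding cinner_self of_real_eq_iff .
  thus ?thesis
    by (simp add: power2_eq_iff_nonneg)
qed

lemma inj_abs_op_iff: "inj (abs_op E) \<longleftrightarrow> inj E"
proof -
  have "abs_op E x = 0 \<longleftrightarrow> E x = 0" for x
    using norm_abs_op[of x] norm_eq_zero[of "abs_op E x"] norm_eq_zero[of "E x"] by argo
  thus ?thesis
    unfolding bounded_ops_inj_iff[OF E]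
      bounded_ops_inj_iff[OF positive_op_bounded_ops[OF positive_op_abs_op]] by blast
qed

end

lemma adj_comp_isometry_comp:
  fixes U :: "'b::chilbert \<Rightarrow> 'c::complex_inner" and B :: "'a::chilbert \<Rightarrow> 'b"
  assumes U: "isometry U" and B: "B \<in> bounded_ops"
  shows "adj (U \<circ> B) \<circ> (U \<circ> B) = adj B \<circ> B"
proof -
  have "adj (U \<circ> B) (U (B x)) = adj B (B x)" for x
    by (rule cinner_ext)
      (simp add: cinner_adj_right[OF bounded_ops_comp[OF isometry_bounded_ops[OF U] B], symmetric]
        cinner_adj_right[OF B, symmetric] cinner_adj_left[OF isometry_bounded_ops[OF U]]
        isometry_adj_apply[OF U])
  thus ?thesis by (simp add: fun_eq_iff)
qed

lemma abs_op_isometry_comp: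
  fixes U :: "'b::chilbert \<Rightarrow> 'c::complex_inner"
  assumes U: "isometry U" and B: "positive_op B"
  shows "abs_op (U \<circ> B) = B"
  unfolding abs_op_def adj_comp_isometry_comp[OF U positive_op_bounded_ops[OF B]]
  by (intro sqrt_op_eqI B) (simp add: adj_positive_op[OF B])

lemma polar_decompositionD:
  assumes "polar_decomposition E U R"
  shows "R = abs_op E" "partial_isometry U" "null_space U = null_space E" "E = U \<circ> R"
  using assms unfolding polar_decomposition_def by blast+

text \<open>The null spaces agree and that of the linear \<open>U\<close> contains 0. This replaces
  linearity of \<open>E\<close>, which is not yet known when the entries of a block operator have to
  be identified.\<close>

lemma polar_decomposition_zero:
  assumes "polar_decomposition E U R"
  shows "E 0 = 0"
proof -
  have "0 \<in> null_space U"
    using polar_decompositionD(2)[OF assms]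
    by (simp add: partial_isometry_def null_space_def bounded_ops_0)
  thus ?thesis
    unfolding polar_decompositionD(3)[OF assms] by (simp add: null_space_def)
qed

lemma polar_decomposition_isometry:
  assumes pd: "polar_decomposition E U R" and "inj E"
  shows "isometry U"
proof -
  have "null_space U = {0}"
    unfolding polar_decompositionD(3)[OF pd]
    using inj_eq[OF assms(2), of _ 0] polar_decomposition_zero[OF pd] by (simp add: null_space_def)
  thus ?thesis
    using polar_decompositionD(2)[OF pd]
    by (simp add: partial_isometry_def isometry_def ortho_compl_def)
qed

text \<open>A selfadjoint injective operator has dense range.\<close>

lemma bounded_ops_eq_if_comp_eq:
  fixes D D' :: "'a::chilbert \<Rightarrow> 'b::complex_inner"
  assumes A: "positive_op A" "inj A" and D: "D \<in> bounded_ops" "D' \<in> bounded_ops"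
    and eq: "\<And>x. D (A x) = D' (A x)"
  shows "D = D'"
proof
  fix x
  define F where "F x = D x - D' x" for x
  have F: "F \<in> bounded_ops"
    unfolding F_def by (rule bounded_ops_minus[OF D])
  \<comment> \<open>Density of the range in dual form: \<open>F\<close> vanishing on the range of
    \<open>A\<close> means that \<open>A\<close> annihilates the range of
    \<open>adj F\<close>.\<close>
  have "A (adj F y) = 0" for y
    by (rule cinner_ext)
      (simp add: positive_op_symmetric[OF A(1)] F_def[of "A _"] eq flip: cinner_adj_right[OF F])
  hence "adj F y = 0" for y
    using bounded_ops_inj_eq_0[OF positive_op_bounded_ops[OF A(1)] A(2)] by blast
  hence "F x = 0"
    by (intro cinner_ext) (simp add: cinner_adj_left[OF F])
  thus "D x = D' x"
    by (simp add: F_def)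
qed

section \<open>Minimal normal extensions\<close>

lemma closed_csubspace_ortho_compl: "closed_csubspace (ortho_compl X)"
  unfolding closed_csubspace_def
proof (intro conjI)
  have "closed (\<Inter>y\<in>X. (\<lambda>x. cinner x y) -` {0})"
    by (intro closed_INT ballI closed_vimage continuous_intros)
  also have "(\<Inter>y\<in>X. (\<lambda>x. cinner x y) -` {0}) = ortho_compl X"
    by (auto simp: ortho_compl_def)
  finally show "closed (ortho_compl X)" .
qed (auto simp: ortho_compl_def cinner_add_left cinner_scaleC_left)

lemma closed_csubspace_closure:
  assumes 0: "0 \<in> L" and add: "\<And>x y. x \<in> L \<Longrightarrow> y \<in> L \<Longrightarrow> x + y \<in> L"
    and scaleC: "\<And>c x. x \<in> L \<Longrightarrow> c *\<^sub>C x \<in> L"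
  shows "closed_csubspace (closure L)"
  unfolding closed_csubspace_def
proof (intro conjI ballI allI)
  show "closed (closure L)" by simp
  show "0 \<in> closure L" using 0 closure_subset by blast
  show "x + y \<in> closure L" if x: "x \<in> closure L" and y: "y \<in> closure L" for x y
  proof -
    obtain f g where "\<forall>n. f n \<in> L" "f \<longlonglongrightarrow> x" "\<forall>n. g n \<in> L" "g \<longlonglongrightarrow> y"
      using x y unfolding closure_sequential by blast
    thus ?thesis
      unfolding closure_sequential by (intro exI[of _ "\<lambda>n. f n + g n"]) (auto intro: tendsto_add add)
  qed
  show "c *\<^sub>C x \<in> closure L" if x: "x \<in> closure L" for c x
  proof -
    obtain f where "\<forall>n. f n \<in> L" "f \<longlonglongrightarrow> x"
      using x unfolding closure_sequential by blast
    thus ?thesis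
      unfolding closure_sequential
      by (intro exI[of _ "\<lambda>n. c *\<^sub>C f n"])
        (auto intro: bounded_linear.tendsto[OF bounded_linear_scaleC] scaleC)
  qed
qed

lemma reducesI:
  fixes N :: "'a::chilbert \<Rightarrow> 'a"
  assumes "N \<in> bounded_ops" "\<And>x. x \<in> M \<Longrightarrow> N x \<in> M" "\<And>x. x \<in> M \<Longrightarrow> adj N x \<in> M"
  shows "reduces M N"
  using assms by (auto simp: reduces_def ortho_compl_def cinner_adj_left)

lemma minimal_normal_extensionD:
  assumes "minimal_normal_extension j S N"
  shows "isometry j" "S \<in> bounded_ops" "N \<in> bounded_ops" "N (j h) = j (S h)"
    "N (adj N x) = adj N (N x)" "normal_op N"
  using assms by (simp_all add: minimal_normal_extension_def normal_extension_def op_extends_def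
      normal_op_def fun_eq_iff)

text \<open>The orthogonal complement of the kernel of \<open>B\<close> reduces \<open>N\<close> and contains the space of \<open>A\<close>.\<close>

lemma minimal_normal_extension_inj:
  fixes j :: "'h::chilbert \<Rightarrow> 'k::chilbert"
  assumes min: "minimal_normal_extension j S N" and A: "A \<in> bounded_ops" "inj A"
    and B: "positive_op B" and comm: "B \<circ> N = N \<circ> B" and ext: "\<And>h. B (j h) = j (A h)"
  shows "inj B"
proof -
  note min' = minimal_normal_extensionD[OF min]
  note jb = isometry_bounded_ops[OF min'(1)] and Bb = positive_op_bounded_ops[OF B]
  define M where "M = ortho_compl (null_space B)"
  have BN: "B (N x) = N (B x)" for x
    using comm by (simp add: fun_eq_iff)
  \<comment> \<open>Self-adjointness of \<open>B\<close> turns commutation with \<open>N\<close>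
    into commutation with \<open>adj N\<close>.\<close>
  have "adj (B \<circ> N) = adj (N \<circ> B)" using comm by simp
  hence BN': "B (adj N x) = adj N (B x)" for x
    by (simp add: adj_comp Bb min' adj_positive_op[OF B] fun_eq_iff)
  have isoj: "cinner (j x) (j y) = cinner x y" for x y
    by (simp add: cinner_adj_left[OF jb] isometry_adj_apply[OF min'(1)])
  have symA: "cinner (A x) y = cinner x (A y)" for x y
    using positive_op_symmetric[OF B, of "j x" "j y"] by (simp add: ext isoj)
  have "j h \<in> M" for h
  proof -
    \<comment> \<open>Tested against all \<open>y\<close>, \<open>A (adj j k)\<close> agrees with
      \<open>adj j (B k)\<close> and so vanishes; injectivity of \<open>A\<close> then gives
      \<open>adj j k = 0\<close>.\<close>
    have "cinner (j h) k = 0" if k: "B k = 0" for k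
    proof -
      have "cinner (A (adj j k)) y = 0" for y
        using positive_op_symmetric[OF B, of k "j y"]
        by (simp add: symA k ext flip: cinner_adj_right[OF jb])
      hence "A (adj j k) = 0"
        by (intro cinner_ext) simp
      hence "adj j k = 0"
        by (rule bounded_ops_inj_eq_0[OF A])
      thus ?thesis
        by (simp add: cinner_adj_left[OF jb])
    qed
    thus ?thesis
      by (simp add: M_def ortho_compl_def null_space_def)
  qed
  moreover have "reduces M N"
  proof (rule reducesI[OF min'(3)])
    show "N x \<in> M" if "x \<in> M" for x
      using that by (simp add: M_def ortho_compl_def null_space_def cinner_adj_left[OF min'(3)]
          BN' bounded_ops_0 adj_bounded_ops min')
    show "adj N x \<in> M" if "x \<in> M" for x
      using that by (simp add: M_def ortho_compl_def null_space_def
          BN bounded_ops_0 min' flip: cinner_adj_right[OF min'(3)])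
  qed
  ultimately have "M = UNIV"
    using min closed_csubspace_ortho_compl[of "null_space B"]
    by (auto simp: minimal_normal_extension_def M_def)
  hence "cinner k k = 0" if "B k = 0" for k
    using that by (auto simp: M_def ortho_compl_def null_space_def set_eq_iff)
  thus ?thesis
    by (simp add: bounded_ops_inj_iff[OF Bb] cinner_self)
qed

text \<open>Taking adjoints in \<open>B \<circ> j = j \<circ> A\<close> gives
  \<open>adj j \<circ> B = A \<circ> adj j\<close>. Together the two identities show that
  \<open>B\<close> commutes with the projection \<open>j \<circ> adj j\<close>.\<close>

lemma positive_op_extension_is_lift:
  fixes j :: "'h::chilbert \<Rightarrow> 'k::chilbert"
  assumes j: "isometry j" and A: "positive_op A" and B: "positive_op B"
    and comm: "N \<circ> B = B \<circ> N" and ext: "\<And>h. B (j h) = j (A h)"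
  shows "is_lift j N A B"
proof -
  note jb = isometry_bounded_ops[OF j]
  have "adj (B \<circ> j) = adj (j \<circ> A)"
    using ext by (simp add: o_def)
  hence "adj j (B x) = A (adj j x)" for x
    by (simp add: adj_comp jb positive_op_bounded_ops A B adj_positive_op fun_eq_iff)
  thus ?thesis
    using comm j ext
    by (simp add: is_lift_def commutant_def positive_op_bounded_ops[OF B] op_extends_def
        ortho_proj_range_isometry fun_eq_iff)
qed

text \<open>The space of \<open>N\<close> is the closed span of the vectors \<open>N\<^sup>*\<^sup>k h\<close>. The adjoint of the lift sends
  \<open>N\<^sup>*\<^sup>k h\<close> to \<open>N\<^sup>*\<^sup>k A h\<close>, and its form at \<open>\<Sum>k. N\<^sup>*\<^sup>k h\<^sub>k\<close> is the squared norm of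
  \<open>\<Sum>k. N\<^sup>*\<^sup>k R h\<^sub>k\<close>, where \<open>R\<close> is the square root of \<open>A\<close>. This makes the lift positive
  without Fuglede's theorem.\<close>

lemma positive_op_lift:
  fixes j :: "'h::chilbert \<Rightarrow> 'k::chilbert"
  assumes min: "minimal_normal_extension j S N" and lift: "is_lift j N A B"
    and A: "positive_op A" and AS: "S \<circ> A = A \<circ> S"
  shows "positive_op B"
proof -
  note min' = minimal_normal_extensionD[OF min]
  note jb = isometry_bounded_ops[OF min'(1)]
  have Bb: "B \<in> bounded_ops" and NB: "N \<circ> B = B \<circ> N"
    and PB: "j \<circ> adj j \<circ> B = B \<circ> (j \<circ> adj j)" and ext: "B (j h) = j (A h)" for h
    using lift by (simp_all add: is_lift_def commutant_def op_extends_def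
        ortho_proj_range_isometry min'(1))
  obtain R where R: "positive_op R" "R \<circ> R = A"
    and RC: "\<forall>C\<in>bounded_ops. C \<circ> A = A \<circ> C \<longrightarrow> C \<circ> R = R \<circ> C"
    using positive_op_sqrt_exists[OF A] by (elim exE conjE) (rule that; assumption)
  have RA: "A h = R (R h)" for h
    using R(2) by (simp add: fun_eq_iff)
  \<comment> \<open>\<open>S\<close> commutes with \<open>A\<close>, hence with its root; this lets
    \<open>R\<close> pass through the powers of \<open>S\<close> produced by the form below.\<close>
  have SR: "(S ^^ k) (R h) = R ((S ^^ k) h)" for k h
    using fun_cong[OF RC[rule_format, OF min'(2) AS]] by (induction k) simp_all
  \<comment> \<open>The generators involve powers of \<open>adj N\<close>. Commutation of
    \<open>B\<close> with \<open>N\<close> says nothing direct about these, but its adjoint says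
    that \<open>C\<close> commutes with \<open>adj N\<close>.\<close>
  define C where "C = adj B"
  have Cb: "C \<in> bounded_ops" and adjC: "adj C = B"
    unfolding C_def by (simp_all add: adj_bounded_ops adj_adj Bb)
  have "adj (N \<circ> B) = adj (B \<circ> N)" using NB by simp
  hence CN: "C (adj N x) = adj N (C x)" for x
    by (simp add: adj_comp Bb min' C_def fun_eq_iff)
  have CNk: "C ((adj N ^^ k) x) = (adj N ^^ k) (C x)" for k x
    by (induction k) (simp_all add: CN)
  have isoj: "cinner (j x) (j y) = cinner x y" for x y
    by (simp add: cinner_adj_left[OF jb] isometry_adj_apply[OF min'(1)])
  \<comment> \<open>Commutation with the projection enters here: \<open>C\<close> also leaves
    \<open>range j\<close> invariant, and its compression to that space is the adjoint of
    \<open>A\<close>, which is \<open>A\<close>.\<close>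
  have Cj: "C (j h) = j (A h)" for h
  proof -
    have "adj (j \<circ> adj j) = j \<circ> adj j"
      by (intro adj_eqI) (simp add: cinner_adj_left[OF jb] cinner_adj_right[OF jb])
    moreover have "adj ((j \<circ> adj j) \<circ> B) = adj (B \<circ> (j \<circ> adj j))" using PB by simp
    ultimately have "C (j (adj j x)) = j (adj j (C x))" for x
      by (simp add: adj_comp[of "j \<circ> adj j" B] adj_comp[of B "j \<circ> adj j"] Bb bounded_ops_comp jb
          adj_bounded_ops C_def fun_eq_iff)
    from this[of "j h"] have "C (j h) = j (adj j (C (j h)))"
      by (simp add: isometry_adj_apply[OF min'(1)])
    also have "adj j (C (j h)) = A h"
      by (rule cinner_ext_right) (simp add: C_def cinner_adj_left[OF jb, symmetric]
          cinner_adj_left[OF Bb, symmetric] ext isoj positive_op_symmetric[OF A])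
    finally show ?thesis .
  qed
  have Nj: "(N ^^ k) (j h) = j ((S ^^ k) h)" for k h
    by (induction k) (simp_all add: min'(4))
  have NN: "(N ^^ k) (adj N x) = adj N ((N ^^ k) x)" for k x
    by (induction k) (simp_all add: min'(5))
  have NNk: "(N ^^ k) ((adj N ^^ l) x) = (adj N ^^ l) ((N ^^ k) x)" for k l x
    by (induction l) (simp_all add: NN)
  have adjNk: "cinner ((adj N ^^ k) x) y = cinner x ((N ^^ k) y)" for k x y
    by (induction k arbitrary: y)
      (simp_all add: cinner_adj_right[OF min'(3), symmetric] funpow_swap1[of N])
  have adjNk': "cinner x ((adj N ^^ k) y) = cinner ((N ^^ k) x) y" for k x y
    using adjNk[of k y x] cinner_commute[of "(N ^^ k) x" y] cinner_commute[of x "(adj N ^^ k) y"]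
    by simp
  \<comment> \<open>Normality lets \<open>N ^^ l\<close> pass \<open>adj N ^^ k\<close>, so that
    only powers of \<open>N\<close> act on \<open>range j\<close>, where they are powers of
    \<open>S\<close>. The exponents change sides.\<close>
  have form: "cinner ((adj N ^^ k) (j x)) ((adj N ^^ l) (j y)) = cinner ((S ^^ l) x) ((S ^^ k) y)"
    for k l x y
    by (simp add: adjNk' NNk) (simp add: adjNk Nj isoj)
  \<comment> \<open>A span of pairs couples a combination of the vectors
    \<open>(adj N ^^ k) (j h)\<close> with the same combination of the vectors
    \<open>(adj N ^^ k) (j (R h))\<close>, without any claim that the second depends only on the
    first.\<close>
  define G where "G = span (range (\<lambda>(k, h). ((adj N ^^ k) (j h), (adj N ^^ k) (j (R h)))))"
  define L where "L = span (range (\<lambda>(k, h). (adj N ^^ k) (j h)))"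
  have form_gen: "cinner (C ((adj N ^^ k) (j x))) ((adj N ^^ l) (j y))
      = cinner ((adj N ^^ k) (j (R x))) ((adj N ^^ l) (j (R y)))" for k l x y
    by (simp add: CNk Cj form SR RA positive_op_symmetric[OF R(1)])
  have form_G: "cinner (C (fst p)) (fst q) = cinner (snd p) (snd q)" if "p \<in> G" "q \<in> G" for p q
    using that(1) unfolding G_def
  proof (induction p rule: span_induct)
    case base
    show ?case
      by (auto simp: subspace_def bounded_ops_add[OF Cb] bounded_ops_0[OF Cb] cinner_add_left
          cinner_scaleR_left linear_scale[OF bounded_linear.linear[OF bounded_ops_bounded_linear[OF Cb]]])
  next
    case (step p)
    then obtain k x where p: "p = ((adj N ^^ k) (j x), (adj N ^^ k) (j (R x)))" by auto
    show ?case
      using that(2) unfolding G_def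
    proof (induction q rule: span_induct)
      case base
      show ?case
        by (auto simp: subspace_def cinner_add_right cinner_scaleR_right)
    next
      case (step q)
      thus ?case by (auto simp: p form_gen)
    qed
  qed
  have L_G: "L = fst ` G"
    unfolding L_def G_def
    by (subst span_linear_image[OF bounded_linear.linear[OF bounded_linear_fst], symmetric])
      (simp add: image_image case_prod_beta)
  have pos_L: "cinner (C u) u \<in> \<real>\<^sub>\<ge>\<^sub>0" if u: "u \<in> L" for u
  proof -
    obtain v where "(u, v) \<in> G" using u L_G by auto
    from form_G[OF this this] show ?thesis
      by (simp add: cinner_self)
  qed
  have L_invariant: "F u \<in> L" if "u \<in> L" "linear F" "\<And>k h. F ((adj N ^^ k) (j h)) \<in> L" for F u
  proof -
    have "F u \<in> F ` span (range (\<lambda>(k, h). (adj N ^^ k) (j h)))"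
      using that(1) by (simp add: L_def)
    also have "\<dots> = span (F ` range (\<lambda>(k, h). (adj N ^^ k) (j h)))"
      using that(2) by (simp add: span_linear_image)
    also have "\<dots> \<subseteq> L"
      unfolding L_def using that(3) by (intro span_minimal) (auto simp: L_def)
    finally show ?thesis .
  qed
  have gen: "(adj N ^^ k) (j h) \<in> L" for k h
    unfolding L_def by (rule span_base) auto
  note Nlin = bounded_ops_bounded_linear[OF min'(3)]
    bounded_ops_bounded_linear[OF adj_bounded_ops[OF min'(3)]]
  have "closed_csubspace (closure L)"
  proof (rule closed_csubspace_closure)
    show "0 \<in> L" "\<And>x y. x \<in> L \<Longrightarrow> y \<in> L \<Longrightarrow> x + y \<in> L"
      by (simp_all add: L_def span_0 span_add)
    \<comment> \<open>\<open>span\<close> is the real span; complex scalars are absorbed into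
      \<open>h\<close>, so \<open>L\<close> is nevertheless a complex subspace.\<close>
    have scaleC: "(adj N ^^ k) (j (c *\<^sub>C h)) = c *\<^sub>C (adj N ^^ k) (j h)" for c k h
      by (induction k)
        (simp_all add: bounded_ops_scaleC[OF jb] bounded_ops_scaleC[OF adj_bounded_ops[OF min'(3)]])
    show "c *\<^sub>C u \<in> L" if "u \<in> L" for c u
      by (rule L_invariant[OF that bounded_linear.linear[OF bounded_linear_scaleC]])
        (unfold scaleC[symmetric], rule gen)
  qed
  moreover have "range j \<subseteq> closure L"
    using gen[of 0] closure_subset by fastforce
  moreover have "reduces (closure L) N"
  proof (rule reducesI[OF min'(3)])
    have "N ((adj N ^^ k) (j h)) \<in> L" for k h
      using NNk[of 1 k "j h"] gen[of k "S h"] by (simp add: min'(4))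
    hence "N ` L \<subseteq> L"
      using L_invariant[OF _ bounded_linear.linear[OF Nlin(1)]] by blast
    thus "N u \<in> closure L" if "u \<in> closure L" for u
      using that closure_bounded_linear_image_subset[OF Nlin(1), of L] closure_mono by blast
    have "adj N ((adj N ^^ k) (j h)) \<in> L" for k h
      using gen[of "Suc k" h] by simp
    hence "adj N ` L \<subseteq> L"
      using L_invariant[OF _ bounded_linear.linear[OF Nlin(2)]] by blast
    thus "adj N u \<in> closure L" if "u \<in> closure L" for u
      using that closure_bounded_linear_image_subset[OF Nlin(2), of L] closure_mono by blast
  qed
  ultimately have "closure L = UNIV"
    using min by (simp add: minimal_normal_extension_def)
  moreover have "closure L \<subseteq> (\<lambda>u. cinner (C u) u) -` \<real>\<^sub>\<ge>\<^sub>0"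
    using pos_L
    by (intro closure_minimal closed_vimage closed_nonneg_Reals_complex continuous_on_cinner
        continuous_on_id linear_continuous_on bounded_ops_bounded_linear[OF Cb]) auto
  ultimately have C: "positive_op C"
    using Cb by (auto simp: positive_op_def)
  thus ?thesis
    using adjC adj_positive_op[OF C] by simp
qed

section \<open>Extensions of Brownian-type operators\<close>

text \<open>A constant vector can be moved between \<open>V\<close> and \<open>E\<close> without
  changing the block operator; the values at 0 exclude this. Set membership provides only some
  entries, and this lemma identifies them with the given ones.\<close>

lemma block_op_upper_eqD:
  assumes eq: "block_op V E (\<lambda>_. 0) X = block_op V' E' (\<lambda>_. 0) X'"
    and "E 0 = 0" "E' 0 = 0" "V' 0 = 0"
  shows "V = V'" "E = E'" "X = X'"
proof -
  have *: "V x + E y = V' x + E' y" "X y = X' y" for x y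
    using fun_cong[OF eq, of "(x, y)"] by (simp_all add: block_op_def)
  show V: "V = V'"
    using *(1)[of _ 0] assms(2,3) by (intro ext) simp
  show "E = E'"
    using *(1)[of 0] assms(4) by (intro ext) (simp add: V)
  show "X = X'"
    using *(2) by (rule ext)
qed

lemma brownian_type_bounded_ops:
  assumes "brownian_type V E X"
  shows "V \<in> bounded_ops" "E \<in> bounded_ops" "X \<in> bounded_ops" "V 0 = 0" "E 0 = 0"
  using assms by (simp_all add: brownian_type_def bounded_ops_0)

lemma brownian_subnormalD:
  assumes "block_op V E (\<lambda>_. 0) X \<in> brownian_subnormal TYPE('l::chilbert)" and E0: "E 0 = 0"
  shows "brownian_type V E X"
proof -
  obtain V' E' X' where eq: "block_op V E (\<lambda>_. 0) X = block_op V' E' (\<lambda>_. 0) X'"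
    and b: "brownian_type V' E' X'"
    using assms(1) unfolding brownian_subnormal_def by blast
  note b' = brownian_type_bounded_ops[OF b]
  show ?thesis
    using b unfolding block_op_upper_eqD[OF eq E0 b'(5,4)] .
qed

lemma brownian_normalD:
  assumes "block_op V E (\<lambda>_. 0) X \<in> brownian_normal" and E0: "E 0 = 0"
  shows "brownian_type V E X"
proof -
  obtain V' E' X' where eq: "block_op V E (\<lambda>_. 0) X = block_op V' E' (\<lambda>_. 0) X'"
    and b: "brownian_type V' E' X'"
    using assms(1) unfolding brownian_normal_def by blast
  note b' = brownian_type_bounded_ops[OF b]
  show ?thesis
    using b unfolding block_op_upper_eqD[OF eq E0 b'(5,4)] .
qed

lemma entrywise_extends_block_op_upper:
  assumes "V 0 = 0" "V' 0 = 0" "E 0 = 0" "E' 0 = 0" "X 0 = 0" "X' 0 = 0"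
  shows "entrywise_extends j1 j2 (block_op V E (\<lambda>_. 0) X) (block_op V' E' (\<lambda>_. 0) X') \<longleftrightarrow>
    op_extends j1 j1 V V' \<and> op_extends j2 j1 E E' \<and> op_extends j2 j2 X X'"
  using assms
  by (auto simp: entrywise_extends_def block_op_def op_extends_def isometry_bounded_ops bounded_ops_0)

text \<open>Assertion (i). The Brownian relation for \<open>E'\<close> makes its modulus commute
  with \<open>N\<close>; the claims about \<open>U\<close> follow by cancelling an injective modulus
  on the right.\<close>

lemma brownian_normal_extension:
  fixes V :: "'h1::chilbert \<Rightarrow> 'h1" and E :: "'h2::chilbert \<Rightarrow> 'h1" and S :: "'h2 \<Rightarrow> 'h2"
    and V' :: "'k1::chilbert \<Rightarrow> 'k1" and E' :: "'k2::chilbert \<Rightarrow> 'k1" and N :: "'k2 \<Rightarrow> 'k2"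
  assumes bt: "brownian_type V E S" and E_inj: "inj E"
    and N_min: "minimal_normal_extension j2 S N"
    and E_polar: "polar_decomposition E W (abs_op E)"
    and mem: "block_op V' E' (\<lambda>_. 0) N \<in> brownian_normal"
    and ext: "entrywise_extends j1 j2 (block_op V E (\<lambda>_. 0) S) (block_op V' E' (\<lambda>_. 0) N)"
    and abs_ext: "op_extends j2 j2 (abs_op E) (abs_op E')"
    and polar: "polar_decomposition E' U (abs_op E')"
  shows "inj E'" "is_lift j2 N (abs_op E) (abs_op E')" "isometry U" "op_extends j2 j1 W U"
    "orthogonal_sets (range V') (range U)"
proof -
  note N' = minimal_normal_extensionD[OF N_min]
  note E0' = polar_decomposition_zero[OF polar]
  note bt' = brownian_normalD[OF mem E0']
  note b = brownian_type_bounded_ops[OF bt] and b' = brownian_type_bounded_ops[OF bt']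
  note E = b(2) and E' = b'(2)
  have extE: "op_extends j2 j1 E E'"
    using ext by (simp add: entrywise_extends_block_op_upper b b'
        bounded_ops_0[OF b(3)] bounded_ops_0[OF b'(3)])
  hence j1: "isometry j1" and E'j: "E' (j2 h) = j1 (E h)" for h
    by (simp_all add: op_extends_def)
  note pos = positive_op_abs_op[OF E] and pos' = positive_op_abs_op[OF E']
  have inj_abs: "inj (abs_op E)"
    using E_inj by (simp add: inj_abs_op_iff[OF E])
  have abs_j: "abs_op E' (j2 h) = j2 (abs_op E h)" for h
    using abs_ext by (simp add: op_extends_def)
  have comm: "N \<circ> abs_op E' = abs_op E' \<circ> N"
    using bt' by (intro abs_op_commute E' b') (simp add: brownian_type_def)
  show lift: "is_lift j2 N (abs_op E) (abs_op E')"
    by (rule positive_op_extension_is_lift[OF N'(1) pos pos' comm abs_j])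
  have inj_abs': "inj (abs_op E')"
    by (rule minimal_normal_extension_inj[OF N_min positive_op_bounded_ops[OF pos] inj_abs pos'
          comm[symmetric] abs_j])
  thus inj': "inj E'"
    by (simp add: inj_abs_op_iff[OF E'])
  show U: "isometry U"
    by (rule polar_decomposition_isometry[OF polar inj'])
  note W = polar_decomposition_isometry[OF E_polar E_inj]
  have EW: "E x = W (abs_op E x)" for x
    by (rule fun_cong[OF polar_decompositionD(4)[OF E_polar], unfolded o_apply])
  have EU: "E' x = U (abs_op E' x)" for x
    by (rule fun_cong[OF polar_decompositionD(4)[OF polar], unfolded o_apply])
  \<comment> \<open>Composed with \<open>abs_op E\<close>, the left side becomes
    \<open>U \<circ> abs_op E' \<circ> j2 = E' \<circ> j2\<close>, the right side
    \<open>j1 \<circ> E\<close>.\<close>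
  have "U \<circ> j2 = j1 \<circ> W"
    by (rule bounded_ops_eq_if_comp_eq[OF pos inj_abs])
      (simp_all add: bounded_ops_comp isometry_bounded_ops U W j1 N'(1) abs_j[symmetric] EU[symmetric]
        EW[symmetric] E'j)
  thus "op_extends j2 j1 W U"
    using N'(1) j1 by (simp add: op_extends_def fun_eq_iff)
  have V': "V' \<in> bounded_ops" by (rule b')
  have "adj V' \<circ> E' = (\<lambda>_. 0)"
    using bt' by (simp add: brownian_type_def)
  hence "adj V' (E' x) = 0" for x
    by (simp add: fun_eq_iff)
  hence "adj V' \<circ> U = (\<lambda>_. 0)"
    by (intro bounded_ops_eq_if_comp_eq[OF pos' inj_abs'])
      (simp_all add: bounded_ops_comp adj_bounded_ops V' isometry_bounded_ops U EU[symmetric]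
        bounded_opsI)
  hence "cinner (V' x) (U y) = 0" for x y
    by (simp add: cinner_adj_left[OF V'] fun_eq_iff)
  thus "orthogonal_sets (range V') (range U)"
    by (auto simp: orthogonal_sets_def)
qed

text \<open>Assertion (ii). Once \<open>B\<close> is positive, \<open>adj U \<circ> U = id\<close>
  gives \<open>abs_op (U \<circ> B) = B\<close>, and the Brownian relation for
  \<open>U \<circ> B\<close> becomes commutation of \<open>N\<close> with
  \<open>B \<circ> B\<close>.\<close>

lemma brownian_normal_extension_of_lift:
  fixes V :: "'h1::chilbert \<Rightarrow> 'h1" and E :: "'h2::chilbert \<Rightarrow> 'h1" and S :: "'h2 \<Rightarrow> 'h2"
    and V' :: "'k1::chilbert \<Rightarrow> 'k1" and U :: "'k2::chilbert \<Rightarrow> 'k1" and N :: "'k2 \<Rightarrow> 'k2"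
  assumes bt: "brownian_type V E S" and E_inj: "inj E"
    and N_min: "minimal_normal_extension j2 S N"
    and E_polar: "polar_decomposition E W (abs_op E)"
    and V': "isometry V'" and U: "isometry U"
    and extV: "op_extends j1 j1 V V'" and extW: "op_extends j2 j1 W U"
    and orth: "orthogonal_sets (range V') (range U)"
    and lift: "is_lift j2 N (abs_op E) B"
  shows "block_op V' (U \<circ> B) (\<lambda>_. 0) N \<in> brownian_normal"
    "entrywise_extends j1 j2 (block_op V E (\<lambda>_. 0) S) (block_op V' (U \<circ> B) (\<lambda>_. 0) N)"
    "op_extends j2 j2 (abs_op E) (abs_op (U \<circ> B))"
    "polar_decomposition (U \<circ> B) U B"
proof -
  note N' = minimal_normal_extensionD[OF N_min]
  note b = brownian_type_bounded_ops[OF bt]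
  note E = b(2) and V'b = isometry_bounded_ops[OF V'] and Ub = isometry_bounded_ops[OF U]
  note pos = positive_op_abs_op[OF E]
  have inj_abs: "inj (abs_op E)"
    using E_inj by (simp add: inj_abs_op_iff[OF E])
  have "S \<circ> abs_op E = abs_op E \<circ> S"
    using bt by (intro abs_op_commute E b) (simp add: brownian_type_def)
  from positive_op_lift[OF N_min lift pos this] have B: "positive_op B" .
  note Bb = positive_op_bounded_ops[OF B]
  have NB: "N \<circ> B = B \<circ> N" and Bj: "B (j2 h) = j2 (abs_op E h)" for h
    using lift by (simp_all add: is_lift_def commutant_def op_extends_def)
  have inj_B: "inj B"
    by (rule minimal_normal_extension_inj[OF N_min positive_op_bounded_ops[OF pos] inj_abs B
          NB[symmetric] Bj])
  have UB: "U \<circ> B \<in> bounded_ops"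
    by (rule bounded_ops_comp[OF Ub Bb])
  have abs: "abs_op (U \<circ> B) = B"
    by (rule abs_op_isometry_comp[OF U B])
  \<comment> \<open>The polar decomposition demands equal null spaces of \<open>U\<close> and
    \<open>U \<circ> B\<close>; injectivity of \<open>B\<close> makes both trivial.\<close>
  have null: "U x = 0 \<longleftrightarrow> x = 0" "B x = 0 \<longleftrightarrow> x = 0" for x
    using isometry_eq_iff[OF U, of x 0] inj_eq[OF inj_B, of x 0]
    by (simp_all add: bounded_ops_0 Ub Bb)
  show "polar_decomposition (U \<circ> B) U B"
    using Ub isometry_norm[OF U]
    by (simp add: polar_decomposition_def abs partial_isometry_def null_space_def null)
  show "op_extends j2 j2 (abs_op E) (abs_op (U \<circ> B))"
    using lift by (simp add: abs is_lift_def)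
  have EW: "E x = W (abs_op E x)" for x
    by (rule fun_cong[OF polar_decompositionD(4)[OF E_polar], unfolded o_apply])
  have j1: "isometry j1" and Uj: "U (j2 h) = j1 (W h)" for h
    using extW by (simp_all add: op_extends_def)
  have "op_extends j2 j1 E (U \<circ> B)"
    using N'(1) j1 by (simp add: op_extends_def Bj Uj EW[symmetric])
  moreover have "op_extends j2 j2 S N"
    using N' by (simp add: op_extends_def)
  ultimately show
    "entrywise_extends j1 j2 (block_op V E (\<lambda>_. 0) S) (block_op V' (U \<circ> B) (\<lambda>_. 0) N)"
    using extV bounded_ops_0[OF UB]
    by (subst entrywise_extends_block_op_upper)
      (simp_all add: b bounded_ops_0 V'b N' bounded_ops_0[OF b(3)])
  obtain x :: 'h1 and y :: 'h2 where "x \<noteq> 0" "y \<noteq> 0"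
    using bt by (auto simp: brownian_type_def)
  \<comment> \<open>Brownian type requires nonzero spaces; the larger ones inherit this through the
    embeddings.\<close>
  hence "j1 x \<noteq> 0" "j2 y \<noteq> 0"
    using isometry_norm[OF j1, of x] isometry_norm[OF N'(1), of y] by auto
  hence "\<exists>x::'k1. x \<noteq> 0" "\<exists>y::'k2. y \<noteq> 0" by blast+
  moreover have "adj V' \<circ> V' = id"
    using V' by (simp add: isometry_iff_adj_comp[OF V'b])
  moreover have "adj V' (U z) = 0" for z
    using orth by (intro cinner_ext_right)
      (auto simp: orthogonal_sets_def cinner_adj_left[OF V'b, symmetric])
  hence "adj V' \<circ> (U \<circ> B) = (\<lambda>_. 0)"
    by (simp add: fun_eq_iff)
  moreover have "N \<circ> adj (U \<circ> B) \<circ> (U \<circ> B) = adj (U \<circ> B) \<circ> (U \<circ> B) \<circ> N"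
  proof -
    have "N (B (B x)) = B (B (N x))" for x
      using fun_cong[OF NB, of x] fun_cong[OF NB, of "B x"] by simp
    thus ?thesis
      unfolding comp_assoc[of N] adj_comp_isometry_comp[OF U Bb] adj_positive_op[OF B]
      by (simp add: fun_eq_iff)
  qed
  ultimately have "brownian_type V' (U \<circ> B) N"
    using V'b UB N'(3) by (simp add: brownian_type_def)
  thus "block_op V' (U \<circ> B) (\<lambda>_. 0) N \<in> brownian_normal"
    using N'(6) by (auto simp: brownian_normal_def)
qed

theorem theorem1p7:
  fixes T :: "'h1::chilbert \<times> 'h2::chilbert \<Rightarrow> 'h1 \<times> 'h2"
    and V :: "'h1 \<Rightarrow> 'h1" and E :: "'h2 \<Rightarrow> 'h1" and S :: "'h2 \<Rightarrow> 'h2"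
    and j2 :: "'h2 \<Rightarrow> 'k2::chilbert" and N :: "'k2 \<Rightarrow> 'k2"
    and W :: "'h2 \<Rightarrow> 'h1"
  assumes T_eq: "T = block_op V E (\<lambda>_. 0) S"
    and T_mem: "T \<in> brownian_subnormal TYPE('l::chilbert)"
    and E_inj: "inj E"
    and N_min: "minimal_normal_extension j2 S N"
    and E_polar: "polar_decomposition E W (abs_op E)"
  shows "inj (abs_op E) \<and> isometry W \<and>
    (\<forall>(j1 :: 'h1 \<Rightarrow> 'k1::chilbert) V' E' U.
       block_op V' E' (\<lambda>_. 0) N \<in> brownian_normal \<and>
       entrywise_extends j1 j2 T (block_op V' E' (\<lambda>_. 0) N) \<and>
       op_extends j2 j2 (abs_op E) (abs_op E') \<and>
       polar_decomposition E' U (abs_op E') \<longrightarrow>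
         inj E' \<and>
         is_lift j2 N (abs_op E) (abs_op E') \<and>
         isometry U \<and> op_extends j2 j1 W U \<and>
         orthogonal_sets (range V') (range U)) \<and>
    (\<forall>(j1 :: 'h1 \<Rightarrow> 'k1) V' U B E'.
       isometry V' \<and> isometry U \<and>
       op_extends j1 j1 V V' \<and> op_extends j2 j1 W U \<and>
       orthogonal_sets (range V') (range U) \<and>
       is_lift j2 N (abs_op E) B \<and>
       E' = U \<circ> B \<longrightarrow>
         block_op V' E' (\<lambda>_. 0) N \<in> brownian_normal \<and>
         entrywise_extends j1 j2 (block_op V E (\<lambda>_. 0) S) (block_op V' E' (\<lambda>_. 0) N) \<and>
         op_extends j2 j2 (abs_op E) (abs_op E') \<and>
         polar_decomposition E' U B)"
proof (intro conjI allI impI; (elim conjE)?)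
  note E0 = polar_decomposition_zero[OF E_polar]
  have bt: "brownian_type V E S"
    by (rule brownian_subnormalD[OF T_mem[unfolded T_eq] E0])
  show "inj (abs_op E)"
    using E_inj by (simp add: inj_abs_op_iff brownian_type_bounded_ops[OF bt])
  show "isometry W"
    by (rule polar_decomposition_isometry[OF E_polar E_inj])
  note i = brownian_normal_extension[OF bt E_inj N_min E_polar, folded T_eq]
  note ii = brownian_normal_extension_of_lift[OF bt E_inj N_min E_polar]
  show "inj E'" "is_lift j2 N (abs_op E) (abs_op E')" "isometry U" "op_extends j2 j1 W U"
    "orthogonal_sets (range V') (range U)"
    if "block_op V' E' (\<lambda>_. 0) N \<in> brownian_normal"
      "entrywise_extends j1 j2 T (block_op V' E' (\<lambda>_. 0) N)"
      "op_extends j2 j2 (abs_op E) (abs_op E')" "polar_decomposition E' U (abs_op E')"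
    for j1 :: "'h1 \<Rightarrow> 'k1::chilbert" and V' E' U
    using i[OF that] .
  show "block_op V' E' (\<lambda>_. 0) N \<in> brownian_normal"
    "entrywise_extends j1 j2 (block_op V E (\<lambda>_. 0) S) (block_op V' E' (\<lambda>_. 0) N)"
    "op_extends j2 j2 (abs_op E) (abs_op E')" "polar_decomposition E' U B"
    if "isometry V'" "isometry U" "op_extends j1 j1 V V'" "op_extends j2 j1 W U"
      "orthogonal_sets (range V') (range U)" "is_lift j2 N (abs_op E) B" and E': "E' = U \<circ> B"
    for j1 :: "'h1 \<Rightarrow> 'k1::chilbert" and V' U B E'
    unfolding E' using ii[OF that(1-6)] .
qed

end
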